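(* There exists a constant $\varepsilon_0>0$ such that any randomized algorithm that, with probability at least $2/3$, estimates the graphic TSP cost of an $n$-vertex instance to within a factor $(1+\varepsilon_0)$ using queries to the distance matrix requires $\Omega(n^2)$ queries. The same holds for $(1,2)$-TSP.
   Context: For a connected unweighted undirected graph $G=(V,E)$ with $n\ge 2$ vertices, the graphic TSP cost is $\min \sum_{i=1}^{n} d_G(v_i,v_{i+1})$ over cyclic orderings $(v_1,\dots,v_n)$ of $V$ ($v_{n+1}=v_1$), where $d_G$ is shortest-path distance; the distance matrix has entries $d_G(u,v)$. A $(1,2)$-TSP instance is a metric on $n$ points with all distances between distinct points in $\{1,2\}$, with cost defined analogously. Estimating to within a factor $c$ means outputting $X$ with $\mathrm{OPT}\le X\le c\,\mathrm{OPT}$. *)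

theory Defs
  imports "HOL-Probability.Probability_Mass_Function" "HOL-Combinatorics.Permutations"
begin

text \<open>Instances live on the vertex/point set {0..<n}. A distance matrix is a function
  nat => nat => nat (entries outside {0..<n} are irrelevant and set to 0 for graph instances).\<close>

definition tour_cost :: "nat \<Rightarrow> (nat \<Rightarrow> nat \<Rightarrow> nat) \<Rightarrow> (nat \<Rightarrow> nat) \<Rightarrow> nat" where
  "tour_cost n d p = (\<Sum>i<n. d (p i) (p (Suc i mod n)))"

definition tsp_cost :: "nat \<Rightarrow> (nat \<Rightarrow> nat \<Rightarrow> nat) \<Rightarrow> nat" where
  "tsp_cost n d = Min {tour_cost n d p | p. p permutes {0..<n}}"

definition simple_graph :: "nat \<Rightarrow> (nat \<Rightarrow> nat \<Rightarrow> bool) \<Rightarrow> bool" where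
  "simple_graph n E \<longleftrightarrow> (\<forall>i j. E i j \<longrightarrow> i < n \<and> j < n \<and> i \<noteq> j \<and> E j i)"

definition walk :: "(nat \<Rightarrow> nat \<Rightarrow> bool) \<Rightarrow> nat list \<Rightarrow> bool" where
  "walk E xs \<longleftrightarrow> xs \<noteq> [] \<and> (\<forall>i. Suc i < length xs \<longrightarrow> E (xs ! i) (xs ! Suc i))"

definition connected_graph :: "nat \<Rightarrow> (nat \<Rightarrow> nat \<Rightarrow> bool) \<Rightarrow> bool" where
  "connected_graph n E \<longleftrightarrow>
     (\<forall>u<n. \<forall>v<n. \<exists>xs. walk E xs \<and> hd xs = u \<and> last xs = v)"

definition graph_dist :: "nat \<Rightarrow> (nat \<Rightarrow> nat \<Rightarrow> bool) \<Rightarrow> nat \<Rightarrow> nat \<Rightarrow> nat" where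
  "graph_dist n E u v =
     (if u < n \<and> v < n
      then (LEAST k. \<exists>xs. walk E xs \<and> hd xs = u \<and> last xs = v \<and> length xs = Suc k)
      else 0)"

definition graphic_instances :: "nat \<Rightarrow> (nat \<Rightarrow> nat \<Rightarrow> nat) set" where
  "graphic_instances n =
     {graph_dist n E | E. simple_graph n E \<and> connected_graph n E}"

text \<open>(1,2)-TSP instances on n points: symmetric, zero diagonal, off-diagonal entries in {1,2}
  (such a function is automatically a metric). Entries outside {0..<n} are 0.\<close>
definition onetwo_instances :: "nat \<Rightarrow> (nat \<Rightarrow> nat \<Rightarrow> nat) set" where
  "onetwo_instances n =
     {d. (\<forall>i j. d i j = d j i) \<and> (\<forall>i. d i i = 0)
         \<and> (\<forall>i j. i < n \<and> j < n \<and> i \<noteq> j \<longrightarrow> d i j \<in> {1, 2})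
         \<and> (\<forall>i j. \<not> (i < n \<and> j < n) \<longrightarrow> d i j = 0)}"

datatype qtree = Leaf real | Query nat nat "nat \<Rightarrow> qtree"

primrec run :: "qtree \<Rightarrow> (nat \<Rightarrow> nat \<Rightarrow> nat) \<Rightarrow> real" where
  "run (Leaf x) d = x"
| "run (Query i j f) d = run (f (d i j)) d"

primrec num_queries :: "qtree \<Rightarrow> (nat \<Rightarrow> nat \<Rightarrow> nat) \<Rightarrow> nat" where
  "num_queries (Leaf x) d = 0"
| "num_queries (Query i j f) d = Suc (num_queries (f (d i j)) d)"

text \<open>A randomized algorithm is a probability distribution over decision trees.
  It estimates TSP within factor c with probability >= 2/3 on every instance of the class.\<close>
definition estimates_tsp ::
  "nat \<Rightarrow> (nat \<Rightarrow> nat \<Rightarrow> nat) set \<Rightarrow> real \<Rightarrow> qtree pmf \<Rightarrow> bool" where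
  "estimates_tsp n Inst c A \<longleftrightarrow>
     (\<forall>d\<in>Inst. measure_pmf.prob A
        {T. real (tsp_cost n d) \<le> run T d \<and> run T d \<le> c * real (tsp_cost n d)} \<ge> 2/3)"

definition uses_at_most ::
  "(nat \<Rightarrow> nat \<Rightarrow> nat) set \<Rightarrow> real \<Rightarrow> qtree pmf \<Rightarrow> bool" where
  "uses_at_most Inst q A \<longleftrightarrow> (\<forall>d\<in>Inst. \<forall>T\<in>set_pmf A. real (num_queries T d) \<le> q)"

end

(*
  Both classes contain the same hard instances: (1,2)-metrics of graphs with a vertex adjacent to
  everything. An instance encodes m = 64 t random clauses with three literals over t Boolean
  variables; which variable a clause slot points to, and with which sign, is hidden in a few
  distance-1 pairs at uniformly random positions, so finding one of them costs about t D queries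
  and o(n^2) queries see only a small fraction of the clauses.

  If the signs are uniform, every assignment violates at least t clauses. If they are conditioned on
  every clause having an odd number of true literals under a random assignment, all clauses are
  satisfiable. Expanding the density of the conditioned distribution into products over sets of
  clauses shows that no run which touches at most K = Theta(t) clauses distinguishes the two: small
  sets average out because a random sparse 3-uniform hypergraph has no small even cover, large sets
  because they contain an untouched clause.

  Variables are ladders which a Hamiltonian path can only traverse in two ways, and a clause is a
  vertex that can be inserted into a ladder only if that ladder is traversed in the direction making
  the corresponding literal true. Hence the optimal tour costs at most n + O(1) plus the
  number of slot collisions, which is small for large D, in the satisfiable case, and exceeds n by
  Omega(t) independently of D in the other case.
*)

theory Submission
  imports Defs "HOL-Library.FuncSet"
begin

section \<open>Decision trees and uniform functions\<close>

text \<open>The constants are fixed in a particular order. In the unsatisfiable case the surplus is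
  about \<open>t / 6000000\<close> whatever \<open>D\<close> is. Only then is \<open>D\<close>
  fixed, so large that slot collisions cost the satisfiable case at most half of that. With
  \<open>D\<close> constant, n is proportional to \<open>t\<close>, so a surplus of order
  \<open>t\<close> is a constant fraction of the tour, and \<open>t * D\<close> queries for each of
  order \<open>t\<close> clauses amount to order n^2. Parity is planted rather than mere
  satisfiability because the condition on a clause is then a single sign character, with density 1 +
  \<open>chi\<close>. The products expand into characters that average to zero exactly, so the two
  distributions agree exactly, not just approximately, on the good event. A tour of an unsatisfiable
  instance may break the gadget rules in places. Soundness is therefore local: rows without
  irregular vertices are rigid, and a second moment of the row degrees limits how many pointers the
  other rows can absorb.\<close>

primrec queries :: "qtree \<Rightarrow> (nat \<Rightarrow> nat \<Rightarrow> nat) \<Rightarrow> (nat \<times> nat) list" where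
  "queries (Leaf x) d = []"
| "queries (Query i j f) d = (i, j) # queries (f (d i j)) d"

lemma length_queries: "length (queries T d) = num_queries T d"
  by (induction T) auto

lemma queries_cong:
  assumes "\<And>u w. (u, w) \<in> set (queries T d) \<Longrightarrow> d u w = d' u w"
  shows "queries T d' = queries T d" and "run T d' = run T d"
proof -
  have "queries T d' = queries T d \<and> run T d' = run T d"
    using assms by (induction T) auto
  then show "queries T d' = queries T d" and "run T d' = run T d"
    by auto
qed

text \<open>The first \<open>k\<close> queries depend only on the answers to these queries, so
  agreement is demanded on the prefix alone. Two instances can thus be compared until a query
  separates them.\<close>

lemma take_queries_cong:
  assumes "\<And>u w. (u, w) \<in> set (take k (queries T d)) \<Longrightarrow> d u w = d' u w"
  shows "take k (queries T d') = take k (queries T d)"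
  using assms
proof (induction T arbitrary: k)
  case (Leaf x)
  then show ?case by simp
next
  case (Query i j f)
  show ?case
  proof (cases k)
    case 0
    then show ?thesis by simp
  next
    case (Suc k')
    then have eq: "d i j = d' i j"
      using Query.prems by simp
    have "take k' (queries (f (d i j)) d') = take k' (queries (f (d i j)) d)"
      using Query.prems Suc by (intro Query.IH) auto
    then show ?thesis
      using eq Suc by simp
  qed
qed

definition splice_on :: "'e set \<Rightarrow> ('e \<Rightarrow> 'z) \<Rightarrow> ('e \<Rightarrow> 'z) \<Rightarrow> 'e \<Rightarrow> 'z" where
  "splice_on B a v = (\<lambda>e. if e \<in> B then v e else a e)"

lemma splice_on_PiE:
  assumes "a \<in> PiE E (\<lambda>_. Z)" "v \<in> PiE E (\<lambda>_. Z)"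
  shows "splice_on B a v \<in> PiE E (\<lambda>_. Z)"
  using assms by (auto simp: splice_on_def PiE_iff extensional_def)

lemma splice_on_splice_on:
  "splice_on B (splice_on B a v) (splice_on B v a) = a"
  by (auto simp: splice_on_def)

text \<open>Swapping the block \<open>B\<close> of two independent uniform functions preserves their joint
  distribution.\<close>

lemma sum_splice_on:
  fixes F :: "('e \<Rightarrow> 'z) \<Rightarrow> ('e \<Rightarrow> 'z) \<Rightarrow> real"
  defines "A \<equiv> \<lambda>E Z. PiE E (\<lambda>_. Z)"
  shows "(\<Sum>a\<in>A E Z. \<Sum>v\<in>A E Z. F (splice_on B a v) (splice_on B v a))
       = (\<Sum>a\<in>A E Z. \<Sum>v\<in>A E Z. F a v)"
proof -
  let ?h = "\<lambda>(a, v). (splice_on B a v, splice_on B v a)"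
  have "(\<Sum>p\<in>A E Z \<times> A E Z. case ?h p of (a, v) \<Rightarrow> F a v) = (\<Sum>(a, v)\<in>A E Z \<times> A E Z. F a v)"
    by (rule sum.reindex_bij_witness[of _ ?h ?h])
       (simp_all add: case_prod_unfold mem_Times_iff splice_on_splice_on A_def splice_on_PiE)
  then show ?thesis
    by (simp add: sum.cartesian_product case_prod_unfold)
qed

section \<open>Probabilities as relative frequencies in finite sets\<close>

definition freq :: "'a set \<Rightarrow> ('a \<Rightarrow> bool) \<Rightarrow> real" where
  "freq A P = real (card {a \<in> A. P a}) / real (card A)"

lemma freq_mono:
  assumes "finite A" "\<And>a. a \<in> A \<Longrightarrow> P a \<Longrightarrow> Q a"
  shows "freq A P \<le> freq A Q"
  unfolding freq_def using assms
  by (intro divide_right_mono) (auto intro!: card_mono)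

lemma freq_cong:
  assumes "\<And>a. a \<in> A \<Longrightarrow> P a \<longleftrightarrow> Q a"
  shows "freq A P = freq A Q"
proof -
  have "{a \<in> A. P a} = {a \<in> A. Q a}"
    using assms by auto
  then show ?thesis
    by (simp add: freq_def)
qed

lemma freq_sum:
  assumes "finite A"
  shows "freq A P = (\<Sum>a\<in>A. of_bool (P a)) / real (card A)"
  using assms by (simp add: freq_def of_bool_def sum.If_cases Int_def)

lemma freq_Ex_le:
  assumes "finite A" "finite I"
  shows "freq A (\<lambda>a. \<exists>i\<in>I. P i a) \<le> (\<Sum>i\<in>I. freq A (P i))"
proof -
  have "{a \<in> A. \<exists>i\<in>I. P i a} = (\<Union>i\<in>I. {a \<in> A. P i a})"
    by auto
  then have "real (card {a \<in> A. \<exists>i\<in>I. P i a}) \<le> real (\<Sum>i\<in>I. card {a \<in> A. P i a})"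
    using card_UN_le[OF assms(2), of "\<lambda>i. {a \<in> A. P i a}"] by (simp del: of_nat_sum)
  then show ?thesis
    unfolding freq_def by (simp add: divide_right_mono flip: sum_divide_distrib)
qed

lemma freq_markov:
  fixes f :: "'a \<Rightarrow> real"
  assumes "finite A" "c > 0" "\<And>a. a \<in> A \<Longrightarrow> f a \<ge> 0"
  shows "freq A (\<lambda>a. f a \<ge> c) \<le> (\<Sum>a\<in>A. f a) / (c * card A)"
proof -
  have "c * (\<Sum>a\<in>A. of_bool (f a \<ge> c)) \<le> (\<Sum>a\<in>A. f a)"
    unfolding sum_distrib_left using assms by (intro sum_mono) auto
  then have "(\<Sum>a\<in>A. of_bool (f a \<ge> c)) \<le> (\<Sum>a\<in>A. f a) / c"
    using assms by (simp add: field_simps)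
  then show ?thesis
    unfolding freq_sum[OF assms(1)] by (metis divide_divide_eq_left divide_right_mono of_nat_0_le_iff)
qed

text \<open>\<open>P\<close> looks only at coordinates in \<open>B\<close> and \<open>Q\<close> only
  at the others; saying so with \<open>splice_on\<close> avoids decomposing the function space as a
  product. Exchanging the block in a double sum turns the summand into a product.\<close>

lemma freq_indep:
  fixes P Q :: "('e \<Rightarrow> 'z) \<Rightarrow> bool"
  defines "A \<equiv> \<lambda>E Z. PiE E (\<lambda>_. Z)"
  assumes fin: "finite E" "finite Z"
    and P: "\<And>a v. a \<in> A E Z \<Longrightarrow> v \<in> A E Z \<Longrightarrow> P (splice_on B a v) = P v"
    and Q: "\<And>a v. a \<in> A E Z \<Longrightarrow> v \<in> A E Z \<Longrightarrow> Q (splice_on B a v) = Q a"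
  shows "freq (A E Z) (\<lambda>a. P a \<and> Q a) = freq (A E Z) P * freq (A E Z) Q"
proof (cases "A E Z = {}")
  case True
  then show ?thesis by (simp add: freq_def)
next
  case False
  have finA: "finite (A E Z)"
    unfolding A_def using fin by (intro finite_PiE) auto
  have "real (card (A E Z)) * (\<Sum>a\<in>A E Z. of_bool (P a \<and> Q a))
      = (\<Sum>a\<in>A E Z. \<Sum>v\<in>A E Z. of_bool (P a \<and> Q a))"
    by (simp add: sum_distrib_left)
  also have "\<dots> = (\<Sum>a\<in>A E Z. \<Sum>v\<in>A E Z. of_bool (P (splice_on B a v) \<and> Q (splice_on B a v)))"
    unfolding A_def by (rule sum_splice_on[symmetric])
  also have "\<dots> = (\<Sum>a\<in>A E Z. \<Sum>v\<in>A E Z. of_bool (Q a) * of_bool (P v))"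
    by (intro sum.cong) (auto simp: P Q)
  also have "\<dots> = (\<Sum>a\<in>A E Z. of_bool (Q a)) * (\<Sum>v\<in>A E Z. of_bool (P v))"
    by (simp add: sum_product)
  finally show ?thesis
    using False finA by (simp add: freq_sum field_simps)
qed

lemma freq_PiE_coord:
  assumes fin: "finite E" "finite Z" and e: "e \<in> E" and Y: "Y \<subseteq> Z" and "Z \<noteq> {}"
  shows "freq (PiE E (\<lambda>_. Z)) (\<lambda>a. a e \<in> Y) = real (card Y) / real (card Z)"
proof -
  have eq: "{a \<in> PiE E (\<lambda>_. Z). a e \<in> Y} = PiE E (\<lambda>e'. if e' = e then Y else Z)"
  proof (rule set_eqI)
    fix a
    have "(\<forall>i\<in>E. a i \<in> Z) \<and> a e \<in> Y \<longleftrightarrow> (\<forall>i\<in>E. a i \<in> (if i = e then Y else Z))"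
      using e Y by (metis subsetD)
    then show "a \<in> {a \<in> PiE E (\<lambda>_. Z). a e \<in> Y} \<longleftrightarrow> a \<in> PiE E (\<lambda>e'. if e' = e then Y else Z)"
      by (auto simp only: PiE_iff mem_Collect_eq)
  qed
  have "card (PiE E (\<lambda>e'. if e' = e then Y else Z)) = card Y * card Z ^ (card E - 1)"
    using fin e by (simp add: card_PiE prod.remove)
  moreover have "card (PiE E (\<lambda>_. Z)) = card Z * card Z ^ (card E - 1)"
    using fin e power_eq_if[of "card Z" "card E"] by (auto simp: card_PiE)
  moreover have "card Z > 0"
    using assms by (simp add: card_gt_0_iff)
  ultimately show ?thesis
    unfolding freq_def eq by simp
qed

text \<open>Given the value z at \<open>e\<close>, the value at \<open>e'\<close> is still uniform,
  and it is related to z with the same probability for every z.\<close>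

lemma freq_PiE_pair:
  assumes fin: "finite E" "finite Z" "Z \<noteq> {}" and e: "e \<in> E" "e' \<in> E" "e \<noteq> e'"
    and R: "\<And>z. z \<in> Z \<Longrightarrow> card {z' \<in> Z. R z z'} = c"
  shows "freq (PiE E (\<lambda>_. Z)) (\<lambda>a. R (a e) (a e')) = real c / real (card Z)"
proof -
  let ?A = "PiE E (\<lambda>_. Z)"
  have finA: "finite ?A"
    using fin by (intro finite_PiE) auto
  have cZ: "real (card Z) > 0"
    using fin by (simp add: card_gt_0_iff)
  have one: "freq ?A (\<lambda>a. a e = z \<and> R z (a e')) = 1 / card Z * (c / card Z)" if "z \<in> Z" for z
  proof -
    have "freq ?A (\<lambda>a. a e = z \<and> R z (a e'))
        = freq ?A (\<lambda>a. a e = z) * freq ?A (\<lambda>a. R z (a e'))"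
      by (rule freq_indep[where B = "{e}"]) (use fin e in \<open>auto simp: splice_on_def\<close>)
    also have "freq ?A (\<lambda>a. a e = z) = freq ?A (\<lambda>a. a e \<in> {z})"
      by simp
    also have "\<dots> = 1 / card Z"
      using fin e that by (subst freq_PiE_coord) auto
    also have "freq ?A (\<lambda>a. R z (a e')) = freq ?A (\<lambda>a. a e' \<in> {z' \<in> Z. R z z'})"
      using e by (intro freq_cong) auto
    also have "\<dots> = c / card Z"
      using fin e that R by (subst freq_PiE_coord) auto
    finally show ?thesis .
  qed
  have "card {a \<in> ?A. R (a e) (a e')} = card (\<Union>z\<in>Z. {a \<in> ?A. a e = z \<and> R z (a e')})"
    using e by (intro arg_cong[where f = card]) auto
  also have "\<dots> = (\<Sum>z\<in>Z. card {a \<in> ?A. a e = z \<and> R z (a e')})"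
    using fin finA by (intro card_UN_disjoint) auto
  finally have "freq ?A (\<lambda>a. R (a e) (a e')) = (\<Sum>z\<in>Z. freq ?A (\<lambda>a. a e = z \<and> R z (a e')))"
    unfolding freq_def by (simp add: sum_divide_distrib)
  also have "\<dots> = (\<Sum>z\<in>Z. 1 / card Z * (c / card Z))"
    by (intro sum.cong one refl)
  also have "\<dots> = real c / real (card Z)"
    using cZ by simp
  finally show ?thesis .
qed

lemma card_coinciding_pairs_eq:
  fixes a :: "'e \<Rightarrow> 'z"
  assumes "finite E"
  shows "real (card {(e, e'). e \<in> E \<and> e' \<in> E \<and> e \<noteq> e' \<and> R (a e) (a e')})
       = (\<Sum>e\<in>E. \<Sum>e'\<in>E - {e}. of_bool (R (a e) (a e')))"
proof -
  have "{(e, e'). e \<in> E \<and> e' \<in> E \<and> e \<noteq> e' \<and> R (a e) (a e')}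
      = (SIGMA e:E. {e' \<in> E - {e}. R (a e) (a e')})"
    by auto
  then show ?thesis
    using assms by (simp add: sum.If_cases Int_def of_bool_def)
qed

lemma freq_coinciding_pairs:
  fixes E :: "'e set" and Z :: "'z set"
  assumes fin: "finite E" "finite Z" "Z \<noteq> {}"
    and R: "\<And>z. z \<in> Z \<Longrightarrow> card {z' \<in> Z. R z z'} = c" and "b > 0"
  shows "freq (PiE E (\<lambda>_. Z))
      (\<lambda>a. real (card {(e, e'). e \<in> E \<and> e' \<in> E \<and> e \<noteq> e' \<and> R (a e) (a e')}) \<ge> b)
    \<le> real (card E)^2 * real c / (b * real (card Z))"
proof -
  let ?A = "PiE E (\<lambda>_. Z)"
  let ?X = "\<lambda>a. real (card {(e, e'). e \<in> E \<and> e' \<in> E \<and> e \<noteq> e' \<and> R (a e) (a e')})"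
  have finA: "finite ?A"
    using fin by (intro finite_PiE) auto
  have "?A \<noteq> {}"
    using fin by (simp add: PiE_eq_empty_iff)
  then have cA: "real (card ?A) > 0"
    using finA by (simp add: card_gt_0_iff)
  have "(\<Sum>a\<in>?A. ?X a) = (\<Sum>a\<in>?A. \<Sum>e\<in>E. \<Sum>e'\<in>E - {e}. of_bool (R (a e) (a e')))"
    by (simp only: card_coinciding_pairs_eq[OF fin(1)])
  also have "\<dots> = (\<Sum>e\<in>E. \<Sum>a\<in>?A. \<Sum>e'\<in>E - {e}. of_bool (R (a e) (a e')))"
    by (rule sum.swap)
  also have "\<dots> = (\<Sum>e\<in>E. \<Sum>e'\<in>E - {e}. \<Sum>a\<in>?A. of_bool (R (a e) (a e')))"
    by (intro sum.cong refl sum.swap)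
  also have "\<dots> = (\<Sum>e\<in>E. \<Sum>e'\<in>E - {e}. card ?A * (real c / real (card Z)))"
  proof (intro sum.cong refl)
    fix e e' assume "e \<in> E" "e' \<in> E - {e}"
    then have "freq ?A (\<lambda>a. R (a e) (a e')) = real c / real (card Z)"
      using fin R by (intro freq_PiE_pair) auto
    then show "(\<Sum>a\<in>?A. of_bool (R (a e) (a e'))) = card ?A * (real c / real (card Z))"
      using cA unfolding freq_sum[OF finA] by (simp add: field_simps)
  qed
  also have "\<dots> \<le> (\<Sum>e\<in>E. \<Sum>e'\<in>E. card ?A * (real c / real (card Z)))"
    using fin by (intro sum_mono sum_mono2) auto
  also have "\<dots> = card ?A * (real (card E)^2 * c / card Z)"
    by (simp add: power2_eq_square)
  finally have le: "(\<Sum>a\<in>?A. ?X a) \<le> card ?A * (real (card E)^2 * c / card Z)" .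
  have "freq ?A (\<lambda>a. ?X a \<ge> b) \<le> (\<Sum>a\<in>?A. ?X a) / (b * card ?A)"
    using finA \<open>b > 0\<close> by (intro freq_markov) auto
  also have "\<dots> \<le> (card ?A * (real (card E)^2 * c / card Z)) / (b * card ?A)"
    using le \<open>b > 0\<close> by (intro divide_right_mono) auto
  also have "\<dots> = real (card E)^2 * c / (b * card Z)"
    using cA by (simp add: field_simps)
  finally show ?thesis .
qed

section \<open>Hidden pointers\<close>

type_synonym pointers = "nat \<times> nat \<Rightarrow> nat \<times> nat"
type_synonym signs = "nat \<Rightarrow> bool \<times> bool \<times> bool"

text \<open>An instance is built from hidden pointers \<open>a (j, s)\<close> (\<open>j < m\<close>, \<open>s < 3\<close>) into
  \<open>t * D\<close> slots and hidden signs \<open>g j\<close>. A query probes at most one slot for at most one \<open>j\<close>, and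
  its answer depends on \<open>a\<close> and \<open>g\<close> only if one of the three pointers of \<open>j\<close> is hit.\<close>

locale hidden_pointers =
  fixes t D m :: nat
    and inst :: "pointers \<Rightarrow> signs \<Rightarrow> nat \<Rightarrow> nat \<Rightarrow> nat"
    and probe :: "nat \<Rightarrow> nat \<Rightarrow> (nat \<times> nat \<times> nat) option"
  assumes t_pos: "t > 0" and D_pos: "D > 0"
    and probe_row: "probe u w = Some (j, z) \<Longrightarrow> fst z < t"
    and inst_cong: "(\<And>j z s. probe u w = Some (j, z) \<Longrightarrow> s < 3 \<Longrightarrow> a (j, s) = z \<or> a' (j, s) = z \<Longrightarrow>
                a (j, s) = a' (j, s) \<and> g j = g' j) \<Longrightarrow> inst a g u w = inst a' g' u w"
begin

definition "slots = {..<t} \<times> {..<D}"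
definition "idx = {..<m} \<times> {..<3::nat}"
definition "ptrs = PiE idx (\<lambda>_. slots)"
definition sgns :: "signs set" where "sgns = PiE {..<m} (\<lambda>_. UNIV)"

definition touched :: "qtree \<Rightarrow> pointers \<Rightarrow> signs \<Rightarrow> nat set" where
  "touched T a g = {j. j < m \<and> (\<exists>(u, w)\<in>set (queries T (inst a g)). \<exists>s<3. probe u w = Some (j, a (j, s)))}"

definition nprobes :: "nat \<Rightarrow> (nat \<times> nat) list \<Rightarrow> nat" where
  "nprobes j qs = length (filter (\<lambda>(u, w). \<exists>z. probe u w = Some (j, z)) qs)"

definition probed :: "nat \<Rightarrow> (nat \<times> nat) list \<Rightarrow> (nat \<times> nat) set" where
  "probed j qs = {z \<in> slots. \<exists>(u, w)\<in>set qs. probe u w = Some (j, z)}"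

lemma finite_slots: "finite slots" and slots_ne: "slots \<noteq> {}" and card_slots: "card slots = t * D"
  using t_pos D_pos by (auto simp: slots_def)

lemma finite_idx: "finite idx" and card_idx: "card idx = 3 * m"
  by (auto simp: idx_def)

lemma finite_ptrs: "finite ptrs"
  unfolding ptrs_def by (intro finite_PiE finite_idx finite_slots)

lemma ptrs_ne: "ptrs \<noteq> {}"
  unfolding ptrs_def using slots_ne by (simp add: PiE_eq_empty_iff)

lemma card_ptrs_pos: "real (card ptrs) > 0"
  using finite_ptrs ptrs_ne by (simp add: card_gt_0_iff)

lemma finite_sgns: "finite sgns"
  unfolding sgns_def by (intro finite_PiE) auto

lemma card_sgns: "card sgns = 8 ^ m"
  unfolding sgns_def by (simp add: card_PiE card_UNIV_bool flip: UNIV_Times_UNIV)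

lemma card_probed_le: "card (probed j qs) \<le> nprobes j qs"
proof -
  let ?qs = "filter (\<lambda>(u, w). \<exists>z. probe u w = Some (j, z)) qs"
  have "probed j qs \<subseteq> (\<lambda>(u, w). snd (the (probe u w))) ` set ?qs"
  proof
    fix z assume "z \<in> probed j qs"
    then obtain u w where "(u, w) \<in> set qs" "probe u w = Some (j, z)"
      by (auto simp: probed_def)
    then show "z \<in> (\<lambda>(u, w). snd (the (probe u w))) ` set ?qs"
      by (intro image_eqI[of _ _ "(u, w)"]) auto
  qed
  then have "card (probed j qs) \<le> card ((\<lambda>(u, w). snd (the (probe u w))) ` set ?qs)"
    by (intro card_mono) auto
  also have "\<dots> \<le> card (set ?qs)"
    by (intro card_image_le) auto
  also have "\<dots> \<le> nprobes j qs"
    unfolding nprobes_def by (rule card_length)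
  finally show ?thesis .
qed

lemma nprobes_take_le: "nprobes j (take k qs) \<le> nprobes j qs"
proof -
  have "nprobes j (xs @ ys) = nprobes j xs + nprobes j ys" for xs ys
    unfolding nprobes_def by simp
  from this[of "take k qs" "drop k qs"] show ?thesis
    by simp
qed

lemma sum_nprobes_le: "(\<Sum>j<m. nprobes j qs) \<le> length qs"
proof (induction qs)
  case Nil
  then show ?case by (simp add: nprobes_def)
next
  case (Cons q qs)
  obtain u w where q: "q = (u, w)"
    by (cases q)
  have step: "nprobes j (q # qs) = of_bool (\<exists>z. probe u w = Some (j, z)) + nprobes j qs" for j
    by (simp add: nprobes_def q)
  have "(\<Sum>j<m. of_bool (\<exists>z. probe u w = Some (j, z)) :: nat) \<le> 1"
  proof (cases "probe u w")
    case None
    then show ?thesis by simp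
  next
    case (Some p)
    then have "(\<Sum>j<m. of_bool (\<exists>z. probe u w = Some (j, z)) :: nat) = (\<Sum>j<m. if j = fst p then 1 else 0)"
      by (intro sum.cong refl) (cases p, auto)
    also have "\<dots> \<le> 1"
      by simp
    finally show ?thesis .
  qed
  then show ?case
    using Cons by (simp add: step sum.distrib)
qed

text \<open>One query adds at most one slot, so the count passes through every value up to its final
  one.\<close>

lemma exists_prefix_card_probed:
  assumes "b \<le> card (probed j qs)"
  shows "\<exists>k. card (probed j (take k qs)) = b"
proof -
  have fin: "finite (probed j xs)" for xs
    using finite_slots by (simp add: probed_def)
  have step: "card (probed j (take (Suc k) qs)) \<le> Suc (card (probed j (take k qs)))" for k
  proof (cases "k < length qs")
    case True
    obtain u w where uw: "qs ! k = (u, w)"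
      by (cases "qs ! k")
    have "probed j (take (Suc k) qs) \<subseteq> insert (snd (the (probe u w))) (probed j (take k qs))"
      using True uw by (auto simp: take_Suc_conv_app_nth probed_def)
    then have "card (probed j (take (Suc k) qs))
             \<le> card (insert (snd (the (probe u w))) (probed j (take k qs)))"
      using fin by (intro card_mono) auto
    also have "\<dots> \<le> Suc (card (probed j (take k qs)))"
      using fin by (simp add: card_insert_if)
    finally show ?thesis .
  qed simp
  define k where "k = (LEAST k. b \<le> card (probed j (take k qs)))"
  have ge: "b \<le> card (probed j (take k qs))"
    unfolding k_def by (rule LeastI[of _ "length qs"]) (use assms in simp)
  have "card (probed j (take k qs)) \<le> b"
  proof (cases k)
    case 0
    then show ?thesis by (simp add: probed_def)
  next
    case (Suc k')
    then have "\<not> b \<le> card (probed j (take k' qs))"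
      unfolding k_def by (intro not_less_Least) auto
    then show ?thesis
      using step[of k'] Suc by simp
  qed
  with ge show ?thesis
    by (intro exI[of _ k]) simp
qed

definition block :: "nat \<Rightarrow> (nat \<times> nat) set" where
  "block j = {j} \<times> {..<3}"

lemma freq_hit_le:
  assumes "j < m" "Y \<subseteq> slots"
  shows "freq ptrs (\<lambda>v. \<exists>s\<in>{..<3}. v (j, s) \<in> Y) \<le> 3 * card Y / (t * D)"
proof -
  have "freq ptrs (\<lambda>v. \<exists>s\<in>{..<3}. v (j, s) \<in> Y) \<le> (\<Sum>s\<in>{..<3::nat}. freq ptrs (\<lambda>v. v (j, s) \<in> Y))"
    by (intro freq_Ex_le finite_ptrs) auto
  also have "\<dots> = (\<Sum>s\<in>{..<3::nat}. card Y / (t * D))"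
    unfolding ptrs_def card_slots[symmetric] using assms finite_idx finite_slots slots_ne
    by (intro sum.cong refl freq_PiE_coord) (auto simp: idx_def)
  also have "\<dots> = 3 * card Y / (t * D)"
    by simp
  finally show ?thesis .
qed

text \<open>With the pointers of all other indices fixed, the run follows the path on which every probe
  of \<open>j\<close> misses until \<open>j\<close> is touched; a pointer avoids the first \<open>t * D / 6\<close> slots probed on that
  path with probability at least \<open>1 / 2\<close>, so touching \<open>j\<close> is paid for by probes of \<open>j\<close>.\<close>

lemma sum_touched_block_le:
  assumes j: "j < m" and a: "a \<in> ptrs" and large: "t * D \<ge> 6"
  defines "a' \<equiv> \<lambda>v. splice_on (block j) a v"
  shows "(\<Sum>v\<in>ptrs. of_bool (j \<in> touched T (a' v) g) :: real)
    \<le> 24 / (t * D) * (\<Sum>v\<in>ptrs. real (nprobes j (queries T (inst (a' v) g))))"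
proof -
  \<comment> \<open>By \<open>probe_row\<close> no probe reaches row \<open>t\<close>, so
    \<open>j\<close> is never hit in \<open>a0\<close>, and \<open>qs\<close> is the path on which
    all probes of \<open>j\<close> miss.\<close>
  define a0 where "a0 = splice_on (block j) a (\<lambda>_. (t, 0))"
  define qs where "qs = queries T (inst a0 g)"
  \<comment> \<open>Three pointers hit a set of at most a sixth of the slots with probability at
    most 1/2. Rounding down loses at most a factor 2 because \<open>t * D\<close> is at least
    6.\<close>
  define b where "b = t * D div 6"
  define Q where "Q v = real (nprobes j (queries T (inst (a' v) g)))" for v
  have b: "b > 0" "6 * b \<le> t * D" "t * D \<le> 12 * b"
    using large unfolding b_def by presburger+
  have same: "inst a0 g u w = inst (a' v) g u w"
    if "(u, w) \<in> set (take k qs)" "\<forall>s\<in>{..<3}. v (j, s) \<notin> probed j (take k qs)" "v \<in> ptrs" for u w v k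
  proof (rule inst_cong)
    fix j' z s
    assume p: "probe u w = Some (j', z)" and s: "s < 3" and hit: "a0 (j', s) = z \<or> a' v (j', s) = z"
    show "a0 (j', s) = a' v (j', s) \<and> g j' = g j'"
    proof (cases "j' = j")
      case True
      have "a0 (j, s) = (t, 0)"
        using s by (simp add: a0_def splice_on_def block_def)
      then have "a0 (j, s) \<noteq> z"
        using probe_row[OF p] by auto
      then have "v (j, s) = z"
        using hit True s by (simp add: a'_def splice_on_def block_def)
      moreover have "v (j, s) \<in> slots"
        using that(3) j s by (auto simp: ptrs_def idx_def)
      ultimately have "v (j, s) \<in> probed j (take k qs)"
        using p that(1) True by (auto simp: probed_def)
      with that(2) s show ?thesis by auto
    next
      case False
      then show ?thesis
        by (simp add: a0_def a'_def splice_on_def block_def)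
    qed
  qed
  have key: "real (card ptrs) * card (probed j (take k qs)) \<le> 2 * (\<Sum>v\<in>ptrs. Q v)"
    if "card (probed j (take k qs)) \<le> b" for k
  proof -
    let ?Y = "probed j (take k qs)"
    have "freq ptrs (\<lambda>v. \<exists>s\<in>{..<3}. v (j, s) \<in> ?Y) \<le> 3 * card ?Y / (t * D)"
      by (rule freq_hit_le[OF j]) (auto simp: probed_def)
    also have "\<dots> \<le> 3 * b / (t * D)"
      using that by (intro divide_right_mono mult_left_mono) auto
    also have "\<dots> \<le> 1 / 2"
    proof -
      have "real (6 * b) \<le> real (t * D)"
        using b(2) of_nat_le_iff by blast
      then show ?thesis
        using large by (simp add: divide_le_eq)
    qed
    finally have half: "2 * real (card {v \<in> ptrs. \<exists>s\<in>{..<3}. v (j, s) \<in> ?Y}) \<le> card ptrs"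
      using card_ptrs_pos by (simp add: freq_def field_simps)
    have "card ?Y \<le> Q v" if v: "v \<in> ptrs" "\<forall>s\<in>{..<3}. v (j, s) \<notin> ?Y" for v
    proof -
      have "take k (queries T (inst (a' v) g)) = take k qs"
        unfolding qs_def using same[of _ _ k v] v by (intro take_queries_cong) (auto simp: qs_def)
      then have "card ?Y \<le> nprobes j (take k (queries T (inst (a' v) g)))"
        using card_probed_le by metis
      then show ?thesis
        unfolding Q_def using nprobes_take_le order_trans of_nat_le_iff by blast
    qed
    then have "(\<Sum>v\<in>ptrs. real (card ?Y) * (1 - of_bool (\<exists>s\<in>{..<3}. v (j, s) \<in> ?Y))) \<le> (\<Sum>v\<in>ptrs. Q v)"
      by (intro sum_mono) (auto simp: Q_def)
    also have "(\<Sum>v\<in>ptrs. real (card ?Y) * (1 - of_bool (\<exists>s\<in>{..<3}. v (j, s) \<in> ?Y)))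
        = card ?Y * (card ptrs - real (card {v \<in> ptrs. \<exists>s\<in>{..<3}. v (j, s) \<in> ?Y}))"
      using finite_ptrs
      by (simp add: sum_subtractf of_bool_def sum.If_cases Int_def flip: sum_distrib_left)
    finally have le: "card ?Y * (card ptrs - real (card {v \<in> ptrs. \<exists>s\<in>{..<3}. v (j, s) \<in> ?Y})) \<le> (\<Sum>v\<in>ptrs. Q v)" .
    have "card ?Y * (real (card ptrs) / 2)
        \<le> card ?Y * (card ptrs - real (card {v \<in> ptrs. \<exists>s\<in>{..<3}. v (j, s) \<in> ?Y}))"
      using half by (intro mult_left_mono) auto
    with le show ?thesis
      by (simp add: mult.commute)
  qed
  have tD: "real (t * D) > 0"
    unfolding of_nat_0_less_iff using large by linarith
  show ?thesis
  \<comment> \<open>If the missing path probes few slots, touching \<open>j\<close> means hitting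
    one of them. Otherwise the trivial bound 1 is paid for by a prefix with exactly \<open>b\<close>
    distinct slots, and 12 * 2 gives the constant 24.\<close>
  proof (cases "card (probed j qs) \<le> b")
    case True
    have "j \<notin> touched T (a' v) g" if v: "v \<in> ptrs" "\<forall>s\<in>{..<3}. v (j, s) \<notin> probed j qs" for v
    proof
      assume "j \<in> touched T (a' v) g"
      then obtain u w s where uw: "(u, w) \<in> set (queries T (inst (a' v) g))" "s < 3"
          "probe u w = Some (j, a' v (j, s))"
        by (auto simp: touched_def)
      have eq: "queries T (inst (a' v) g) = qs"
        unfolding qs_def using same[of _ _ "length qs" v] v by (intro queries_cong) (auto simp: qs_def)
      have "a' v (j, s) = v (j, s)"
        using uw by (simp add: a'_def splice_on_def block_def)
      moreover have "v (j, s) \<in> slots"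
        using v(1) j uw by (auto simp: ptrs_def idx_def)
      ultimately have "v (j, s) \<in> probed j qs"
        using uw eq by (auto simp: probed_def)
      with v uw show False by auto
    qed
    then have "(\<Sum>v\<in>ptrs. of_bool (j \<in> touched T (a' v) g) :: real)
      \<le> (\<Sum>v\<in>ptrs. of_bool (\<exists>s\<in>{..<3}. v (j, s) \<in> probed j qs))"
      by (intro sum_mono) auto
    also have "\<dots> = card ptrs * freq ptrs (\<lambda>v. \<exists>s\<in>{..<3}. v (j, s) \<in> probed j qs)"
      using card_ptrs_pos by (simp add: freq_sum[OF finite_ptrs])
    also have "\<dots> \<le> card ptrs * (3 * card (probed j qs) / (t * D))"
      by (intro mult_left_mono freq_hit_le j) (auto simp: probed_def)
    also have "\<dots> = 3 / (t * D) * (card ptrs * card (probed j qs))"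
      by simp
    also have "\<dots> \<le> 3 / (t * D) * (2 * (\<Sum>v\<in>ptrs. Q v))"
      using key[of "length qs"] True by (intro mult_left_mono) auto
    also have "\<dots> \<le> 24 / (t * D) * (\<Sum>v\<in>ptrs. Q v)"
      using tD by (auto simp: Q_def sum_nonneg field_simps)
    finally show ?thesis
      by (simp add: Q_def)
  next
    case False
    then obtain k where k: "card (probed j (take k qs)) = b"
      using exists_prefix_card_probed[of b j qs] by auto
    have "(\<Sum>v\<in>ptrs. of_bool (j \<in> touched T (a' v) g) :: real) \<le> (\<Sum>v\<in>ptrs. 1 :: real)"
      by (intro sum_mono) auto
    also have "\<dots> = real (card ptrs) * 1"
      by simp
    also have "\<dots> \<le> real (card ptrs) * (real (12 * b) / real (t * D))"
    proof (rule mult_left_mono)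
      have "real (t * D) \<le> real (12 * b)"
        using b(3) of_nat_le_iff by blast
      then show "1 \<le> real (12 * b) / real (t * D)"
        using tD by (simp add: field_simps)
    qed simp
    also have "\<dots> = 12 / (t * D) * (card ptrs * b)"
      by simp
    also have "\<dots> \<le> 12 / (t * D) * (2 * (\<Sum>v\<in>ptrs. Q v))"
      using key[of k] k by (intro mult_left_mono) auto
    finally show ?thesis
      by (simp add: Q_def)
  qed
qed

lemma sum_card_touched_le:
  assumes large: "t * D \<ge> 6"
    and q: "\<And>a. a \<in> ptrs \<Longrightarrow> real (num_queries T (inst a g)) \<le> q"
  shows "(\<Sum>a\<in>ptrs. real (card (touched T a g))) \<le> 24 * q / (t * D) * card ptrs"
proof -
  have single: "(\<Sum>a\<in>ptrs. of_bool (j \<in> touched T a g) :: real)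
      \<le> 24 / (t * D) * (\<Sum>a\<in>ptrs. real (nprobes j (queries T (inst a g))))" if j: "j < m" for j
  proof -
    \<comment> \<open>Resampling the three pointers of \<open>j\<close> preserves the uniform
      distribution, so the bound for fixed other pointers averages to a bound over all of
      \<open>ptrs\<close>.\<close>
    have mix: "card ptrs * (\<Sum>a\<in>ptrs. f a)
        = (\<Sum>a\<in>ptrs. \<Sum>v\<in>ptrs. f (splice_on (block j) a v))" for f :: "pointers \<Rightarrow> real"
    proof -
      have "(\<Sum>a\<in>ptrs. \<Sum>v\<in>ptrs. f (splice_on (block j) a v)) = (\<Sum>a\<in>ptrs. \<Sum>v\<in>ptrs. f a)"
        unfolding ptrs_def by (rule sum_splice_on)
      then show ?thesis
        by (simp add: sum_distrib_left)
    qed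
    have "card ptrs * (\<Sum>a\<in>ptrs. of_bool (j \<in> touched T a g) :: real)
        = (\<Sum>a\<in>ptrs. \<Sum>v\<in>ptrs. of_bool (j \<in> touched T (splice_on (block j) a v) g))"
      by (rule mix)
    also have "\<dots> \<le> (\<Sum>a\<in>ptrs. 24 / (t * D) *
        (\<Sum>v\<in>ptrs. real (nprobes j (queries T (inst (splice_on (block j) a v) g)))))"
      by (intro sum_mono sum_touched_block_le j large)
    also have "\<dots> = 24 / (t * D) * (card ptrs * (\<Sum>a\<in>ptrs. real (nprobes j (queries T (inst a g)))))"
      unfolding mix by (simp only: sum_distrib_left)
    finally have "card ptrs * (\<Sum>a\<in>ptrs. of_bool (j \<in> touched T a g) :: real)
        \<le> card ptrs * (24 / (t * D) * (\<Sum>a\<in>ptrs. real (nprobes j (queries T (inst a g)))))"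
      by (simp only: mult.left_commute)
    then show ?thesis
      using card_ptrs_pos by (rule mult_left_le_imp_le)
  qed
  have "(\<Sum>a\<in>ptrs. real (card (touched T a g))) = (\<Sum>a\<in>ptrs. \<Sum>j<m. of_bool (j \<in> touched T a g) :: real)"
    by (intro sum.cong) (auto simp: of_bool_def sum.If_cases touched_def intro!: arg_cong[where f = card])
  also have "\<dots> = (\<Sum>j<m. \<Sum>a\<in>ptrs. of_bool (j \<in> touched T a g))"
    by (rule sum.swap)
  also have "\<dots> \<le> (\<Sum>j<m. 24 / (t * D) * (\<Sum>a\<in>ptrs. real (nprobes j (queries T (inst a g)))))"
    by (intro sum_mono single) auto
  also have "\<dots> = 24 / (t * D) * (\<Sum>a\<in>ptrs. \<Sum>j<m. real (nprobes j (queries T (inst a g))))"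
    by (subst sum.swap) (simp add: sum_distrib_left)
  also have "\<dots> \<le> 24 / (t * D) * (\<Sum>a\<in>ptrs. q)"
  proof (intro mult_left_mono sum_mono)
    fix a assume "a \<in> ptrs"
    have "(\<Sum>j<m. real (nprobes j (queries T (inst a g)))) \<le> real (num_queries T (inst a g))"
      using sum_nprobes_le[of "queries T (inst a g)"]
      by (metis length_queries of_nat_le_iff of_nat_sum)
    with q[OF \<open>a \<in> ptrs\<close>] show "(\<Sum>j<m. real (nprobes j (queries T (inst a g)))) \<le> q"
      by linarith
  qed auto
  finally show ?thesis
    by (simp add: mult_ac)
qed

text \<open>The signs of a clause influence an answer only where one of its pointers is hit, so the
  signs of untouched clauses can be changed behind the back of the run.\<close>

lemma touched_cong:
  assumes "\<And>j. j \<notin> J \<Longrightarrow> g j = g' j" and "J \<inter> touched T a g = {}" and "J \<subseteq> {..<m}"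
  shows "touched T a g' = touched T a g" and "run T (inst a g') = run T (inst a g)"
proof -
  have eq: "inst a g u w = inst a g' u w" if "(u, w) \<in> set (queries T (inst a g))" for u w
  proof (rule inst_cong)
    fix j z s
    assume p: "probe u w = Some (j, z)" "s < 3" "a (j, s) = z \<or> a (j, s) = z"
    have "j \<notin> J"
    proof
      assume "j \<in> J"
      then have "j < m"
        using assms(3) by auto
      moreover have "probe u w = Some (j, a (j, s))"
        using p by auto
      ultimately have "j \<in> touched T a g"
        unfolding touched_def using p(2) that by blast
      with \<open>j \<in> J\<close> assms(2) show False by auto
    qed
    then show "a (j, s) = a (j, s) \<and> g j = g' j"
      using assms(1) by simp
  qed
  show "touched T a g' = touched T a g"
    unfolding touched_def using queries_cong(1)[of T "inst a g" "inst a g'", OF eq] by simp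
  show "run T (inst a g') = run T (inst a g)"
    using queries_cong(2)[of T "inst a g" "inst a g'", OF eq] by simp
qed

end

section \<open>Planted signs\<close>

text \<open>Parity in multiplicative form, so that parity conditions become products that can be
  expanded.\<close>

definition sg :: "bool \<Rightarrow> real" where
  "sg b = (if b then -1 else 1)"

fun sel :: "bool \<times> bool \<times> bool \<Rightarrow> nat \<Rightarrow> bool" where
  "sel (b0, b1, b2) s = (if s = 0 then b0 else if s = 1 then b1 else b2)"

text \<open>Negating one of the three signs is enough to reverse their product.\<close>

definition flip :: "nat \<Rightarrow> signs \<Rightarrow> signs" where
  "flip j g = g(j := (case g j of (b0, b1, b2) \<Rightarrow> (\<not> b0, b1, b2)))"

lemma flip_flip [simp]: "flip j (flip j g) = g"
  by (auto simp: flip_def split: prod.splits)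

lemma prod_less_3: "(\<Prod>s<3. f s) = f 0 * f 1 * (f 2 :: real)" for f :: "nat \<Rightarrow> real"
  by (simp add: numeral_3_eq_3 numeral_2_eq_2)

lemma prod_sel_flip:
  "(\<Prod>s<3. sg (sel (flip j g i) s)) = (if i = j then -1 else 1) * (\<Prod>s<3. sg (sel (g i) s))"
proof (cases "g i")
  case (fields b0 b1 b2)
  then show ?thesis
    by (simp only: prod_less_3) (auto simp: flip_def sg_def)
qed

lemma sum_involution_eq_0:
  fixes f :: "'a \<Rightarrow> real"
  assumes "\<And>x. x \<in> A \<Longrightarrow> h x \<in> A" "\<And>x. x \<in> A \<Longrightarrow> h (h x) = x" "\<And>x. x \<in> A \<Longrightarrow> f (h x) = - f x"
  shows "(\<Sum>x\<in>A. f x) = 0"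
proof -
  have "(\<Sum>x\<in>A. f x) = (\<Sum>x\<in>A. - f x)"
    by (rule sum.reindex_bij_witness[of _ h h]) (use assms in auto)
  then show ?thesis
    by (simp add: sum_negf)
qed

context hidden_pointers
begin

definition asgs :: "(nat \<Rightarrow> bool) set" where
  "asgs = PiE {..<t} (\<lambda>_. UNIV)"

definition chi :: "pointers \<Rightarrow> (nat \<Rightarrow> bool) \<Rightarrow> signs \<Rightarrow> nat \<Rightarrow> real" where
  "chi a x g j = (\<Prod>s<3. sg (sel (g j) s)) * (\<Prod>s<3. sg (x (fst (a (j, s)))))"

text \<open>The density, with respect to uniform \<open>(x, g)\<close>, of the planted distribution: every index has
  an even number of signs disagreeing with \<open>x\<close>.\<close>

definition planted :: "pointers \<Rightarrow> (nat \<Rightarrow> bool) \<Rightarrow> signs \<Rightarrow> real" where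
  "planted a x g = (\<Prod>j<m. chi a x g j + 1)"

text \<open>What is excluded is a small even cover: a set of clauses that points to every row an
  even number of times. On such a set the part of the product of \<open>chi\<close> that involves
  \<open>x\<close> is identically 1, so planted signs would satisfy a detectable linear
  relation.\<close>

definition cover_free :: "nat \<Rightarrow> pointers \<Rightarrow> bool" where
  "cover_free K a \<longleftrightarrow> (\<forall>S\<subseteq>{..<m}. S \<noteq> {} \<and> card S \<le> K \<longrightarrow>
      (\<exists>i<t. odd (card {e \<in> S \<times> {..<3}. fst (a e) = i})))"

lemma finite_asgs: "finite asgs" and card_asgs: "card asgs = 2 ^ t"
  unfolding asgs_def by (auto intro: finite_PiE simp: card_PiE card_UNIV_bool)

lemma flip_sgns: "j < m \<Longrightarrow> g \<in> sgns \<Longrightarrow> flip j g \<in> sgns"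
  by (auto simp: sgns_def flip_def PiE_iff extensional_def)

text \<open>Negating \<open>x\<close> at the row of odd multiplicity reverses the sign of every
  summand.\<close>

lemma sum_asgs_eq_0:
  fixes S :: "nat set" and a :: pointers
  assumes S: "finite S" and i: "i < t" "odd (card {e \<in> S \<times> {..<3::nat}. fst (a e) = i})"
  shows "(\<Sum>x\<in>asgs. \<Prod>j\<in>S. \<Prod>s<3. sg (x (fst (a (j, s))))) = 0"
proof (rule sum_involution_eq_0)
  let ?h = "\<lambda>x. x(i := \<not> x i)"
  fix x assume x: "x \<in> asgs"
  show "?h x \<in> asgs"
    using x i by (auto simp: asgs_def PiE_iff extensional_def)
  show "?h (?h x) = x"
    by auto
  have cart: "(\<Prod>j\<in>S. \<Prod>s<3. f (j, s)) = (\<Prod>e\<in>S \<times> {..<3}. f e)" for f :: "nat \<times> nat \<Rightarrow> real"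
    by (simp add: prod.cartesian_product)
  have flip: "sg ((?h x) (fst (a e))) = (if fst (a e) = i then -1 else 1) * sg (x (fst (a e)))" for e
    by (auto simp: sg_def)
  have "(\<Prod>j\<in>S. \<Prod>s<3. sg ((?h x) (fst (a (j, s))))) = (\<Prod>e\<in>S \<times> {..<3}. sg ((?h x) (fst (a e))))"
    by (rule cart[of "\<lambda>e. sg ((?h x) (fst (a e)))"])
  also have "\<dots> = (\<Prod>e\<in>S \<times> {..<3}. if fst (a e) = i then -1 else 1) * (\<Prod>e\<in>S \<times> {..<3}. sg (x (fst (a e))))"
    by (simp only: flip prod.distrib)
  also have "(\<Prod>e\<in>S \<times> {..<3::nat}. if fst (a e) = i then -1 else 1 :: real) = (-1) ^ card {e \<in> S \<times> {..<3::nat}. fst (a e) = i}"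
    using S by (simp add: prod.If_cases Int_def)
  also have "\<dots> = -1"
    using i by simp
  also have "(\<Prod>e\<in>S \<times> {..<3}. sg (x (fst (a e)))) = (\<Prod>j\<in>S. \<Prod>s<3. sg (x (fst (a (j, s)))))"
    by (rule cart[of "\<lambda>e. sg (x (fst (a e)))", symmetric])
  finally show "(\<Prod>j\<in>S. \<Prod>s<3. sg ((?h x) (fst (a (j, s))))) = - (\<Prod>j\<in>S. \<Prod>s<3. sg (x (fst (a (j, s)))))"
    by simp
qed

text \<open>Flip the least index of \<open>S\<close> outside \<open>J g\<close>. Since
  \<open>J\<close> and \<open>\<phi>\<close> ignore such flips, the same index is chosen again, so
  this is a sign-reversing involution; where no such index exists, \<open>\<phi> g\<close> is 0.
  With \<open>J\<close> the touched set, it says that a run is uncorrelated with a sign it has not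
  seen.\<close>

lemma sum_sgns_eq_0:
  assumes S: "S \<subseteq> {..<m}" and big: "\<And>g. g \<in> sgns \<Longrightarrow> \<phi> g \<noteq> 0 \<Longrightarrow> \<not> S \<subseteq> J g"
    and J: "\<And>g j. g \<in> sgns \<Longrightarrow> j < m \<Longrightarrow> j \<notin> J g \<Longrightarrow> J (flip j g) = J g"
    and \<phi>: "\<And>g j. g \<in> sgns \<Longrightarrow> j < m \<Longrightarrow> j \<notin> J g \<Longrightarrow> \<phi> (flip j g) = \<phi> g"
  shows "(\<Sum>g\<in>sgns. \<phi> g * (\<Prod>j\<in>S. \<Prod>s<3. sg (sel (g j) s))) = (0 :: real)"
proof -
  have finS: "finite S"
    using S finite_subset by blast
  define h where "h g = (if S \<subseteq> J g then g else flip (Min (S - J g)) g)" for g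
  have Min: "Min (S - J g) \<in> S - J g" if "\<not> S \<subseteq> J g" for g
    using that finS by (intro Min_in) auto
  have Jh: "J (h g) = J g" if "g \<in> sgns" for g
    using Min[of g] S J[OF that, of "Min (S - J g)"] by (auto simp: h_def)
  show ?thesis
  proof (rule sum_involution_eq_0[of _ h])
    fix g assume g: "g \<in> sgns"
    show "h g \<in> sgns"
      using g Min[of g] S by (auto simp: h_def intro!: flip_sgns)
    show "h (h g) = g"
      using Jh[OF g] by (simp add: h_def split: if_splits)
    show "\<phi> (h g) * (\<Prod>j\<in>S. \<Prod>s<3. sg (sel (h g j) s)) = - (\<phi> g * (\<Prod>j\<in>S. \<Prod>s<3. sg (sel (g j) s)))"
    proof (cases "S \<subseteq> J g")
      case True
      then have "\<phi> g = 0"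
        using big g by blast
      then show ?thesis
        using True by (simp add: h_def)
    next
      case False
      define j0 where "j0 = Min (S - J g)"
      have j0: "j0 \<in> S" "j0 \<notin> J g"
        using Min[OF False] by (auto simp: j0_def)
      have "(\<Prod>j\<in>S. \<Prod>s<3. sg (sel (flip j0 g j) s))
          = (\<Prod>j\<in>S. (if j = j0 then -1 else 1)) * (\<Prod>j\<in>S. \<Prod>s<3. sg (sel (g j) s))"
        by (simp only: prod_sel_flip prod.distrib)
      also have "(\<Prod>j\<in>S. (if j = j0 then -1 else 1 :: real)) = -1"
        using j0 finS by (simp add: prod.delta)
      finally show ?thesis
        using False \<phi>[OF g, of j0] j0 S by (auto simp: h_def j0_def[symmetric])
    qed
  qed
qed

lemma sum_planted:
  "(\<Sum>x\<in>asgs. \<Sum>g\<in>sgns. planted a x g * \<phi> g)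
      = (\<Sum>S\<in>Pow {..<m}. (\<Sum>g\<in>sgns. \<phi> g * (\<Prod>j\<in>S. \<Prod>s<3. sg (sel (g j) s)))
          * (\<Sum>x\<in>asgs. \<Prod>j\<in>S. \<Prod>s<3. sg (x (fst (a (j, s))))))"
proof -
  have "(\<Sum>x\<in>asgs. \<Sum>g\<in>sgns. planted a x g * \<phi> g)
      = (\<Sum>x\<in>asgs. \<Sum>g\<in>sgns. \<Sum>S\<in>Pow {..<m}. (\<phi> g * (\<Prod>j\<in>S. \<Prod>s<3. sg (sel (g j) s)))
          * (\<Prod>j\<in>S. \<Prod>s<3. sg (x (fst (a (j, s))))))"
    unfolding planted_def prod_add[OF finite_lessThan] chi_def prod.distrib prod.neutral_const
    by (simp add: sum_distrib_right sum_distrib_left mult_ac)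
  also have "\<dots> = (\<Sum>x\<in>asgs. \<Sum>S\<in>Pow {..<m}. (\<Sum>g\<in>sgns. \<phi> g * (\<Prod>j\<in>S. \<Prod>s<3. sg (sel (g j) s)))
          * (\<Prod>j\<in>S. \<Prod>s<3. sg (x (fst (a (j, s))))))"
    by (intro sum.cong refl) (subst sum.swap, simp add: sum_distrib_right)
  also have "\<dots> = (\<Sum>S\<in>Pow {..<m}. (\<Sum>g\<in>sgns. \<phi> g * (\<Prod>j\<in>S. \<Prod>s<3. sg (sel (g j) s)))
          * (\<Sum>x\<in>asgs. \<Prod>j\<in>S. \<Prod>s<3. sg (x (fst (a (j, s))))))"
    by (subst sum.swap) (simp add: sum_distrib_left)
  finally show ?thesis .
qed

text \<open>Averaging over the signs already kills every nonempty \<open>S\<close>, whatever the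
  pointers are. Hence the pointers are uniform under the planted distribution too, even where small
  even covers exist.\<close>

lemma sum_planted_const: "(\<Sum>x\<in>asgs. \<Sum>g\<in>sgns. planted a x g) = 2 ^ t * 8 ^ m"
proof -
  have "(\<Sum>x\<in>asgs. \<Sum>g\<in>sgns. planted a x g * 1)
      = (\<Sum>S\<in>Pow {..<m}. if S = {} then 8 ^ m * 2 ^ t else 0)"
  proof (subst sum_planted, intro sum.cong refl)
    fix S assume S: "S \<in> Pow {..<m}"
    show "(\<Sum>g\<in>sgns. 1 * (\<Prod>j\<in>S. \<Prod>s<3. sg (sel (g j) s))) * (\<Sum>x\<in>asgs. \<Prod>j\<in>S. \<Prod>s<3. sg (x (fst (a (j, s)))))
        = (if S = {} then 8 ^ m * 2 ^ t else 0)"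
    proof (cases "S = {}")
      case True
      then show ?thesis
        by (simp add: card_sgns card_asgs)
    next
      case False
      have "(\<Sum>g\<in>sgns. 1 * (\<Prod>j\<in>S. \<Prod>s<3. sg (sel (g j) s))) = 0"
        by (rule sum_sgns_eq_0[where J = "\<lambda>_. {}"]) (use S False in auto)
      then show ?thesis
        using False by simp
    qed
  qed
  then show ?thesis
    by simp
qed

text \<open>Expanding \<open>planted\<close> over subsets \<open>S\<close> of indices, a nonempty \<open>S\<close> contributes nothing: if it is
  small, averaging over \<open>x\<close> kills it; if it is large, it contains an untouched index, whose sign the
  run does not see.\<close>

lemma sum_planted_run:
  fixes T :: qtree and P :: "real \<Rightarrow> bool"
  assumes free: "cover_free K a"
  defines "\<phi> \<equiv> \<lambda>g. of_bool (P (run T (inst a g)) \<and> card (touched T a g) \<le> K) :: real"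
  shows "(\<Sum>x\<in>asgs. \<Sum>g\<in>sgns. planted a x g * \<phi> g) = 2 ^ t * (\<Sum>g\<in>sgns. \<phi> g)"
proof -
  have "(\<Sum>x\<in>asgs. \<Sum>g\<in>sgns. planted a x g * \<phi> g)
      = (\<Sum>S\<in>Pow {..<m}. if S = {} then (\<Sum>g\<in>sgns. \<phi> g) * 2 ^ t else 0)"
  proof (subst sum_planted, intro sum.cong refl)
    fix S assume S: "S \<in> Pow {..<m}"
    then have finS: "finite S"
      using finite_subset by blast
    consider "S = {}" | "S \<noteq> {}" "card S \<le> K" | "K < card S"
      by linarith
    then show "(\<Sum>g\<in>sgns. \<phi> g * (\<Prod>j\<in>S. \<Prod>s<3. sg (sel (g j) s))) * (\<Sum>x\<in>asgs. \<Prod>j\<in>S. \<Prod>s<3. sg (x (fst (a (j, s)))))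
        = (if S = {} then (\<Sum>g\<in>sgns. \<phi> g) * 2 ^ t else 0)"
    proof cases
      case 1
      then show ?thesis
        by (simp add: card_asgs)
    next
      case 2
      then obtain i where "i < t" "odd (card {e \<in> S \<times> {..<3}. fst (a e) = i})"
        using free S by (auto simp: cover_free_def)
      then show ?thesis
        using 2 sum_asgs_eq_0[OF finS, of i a] by simp
    next
      case 3
      have inv: "touched T a (flip j g) = touched T a g \<and> run T (inst a (flip j g)) = run T (inst a g)"
        if "j < m" "j \<notin> touched T a g" for j g
        using that touched_cong[of "{j}" g "flip j g" T a] by (auto simp: flip_def)
      have "(\<Sum>g\<in>sgns. \<phi> g * (\<Prod>j\<in>S. \<Prod>s<3. sg (sel (g j) s))) = 0"
      proof (rule sum_sgns_eq_0[where J = "touched T a"])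
        fix g assume "\<phi> g \<noteq> 0"
        then have "card (touched T a g) < card S"
          using 3 by (auto simp: \<phi>_def)
        moreover have "finite (touched T a g)"
          by (simp add: touched_def)
        ultimately show "\<not> S \<subseteq> touched T a g"
          using card_mono leD by blast
      qed (use S inv in \<open>auto simp: \<phi>_def\<close>)
      then show ?thesis
        using 3 by auto
    qed
  qed
  then show ?thesis
    by simp
qed

section \<open>Small even covers are unlikely\<close>

lemma ptrs_row: "a \<in> ptrs \<Longrightarrow> e \<in> idx \<Longrightarrow> fst (a e) < t"
  by (cases "a e") (auto simp: ptrs_def slots_def dest: PiE_mem)

text \<open>Some other pointer must share the row of a given \<open>e0\<close>, since its fibre has
  even size, and removing both leaves even fibres. Each of fewer than |F| partners agrees with
  probability 1/t, independently of the rest, so every round contributes a factor |F|/t.\<close>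

lemma freq_even_fibres_le:
  assumes "finite F" "F \<subseteq> idx" "card F = 2 * h"
  shows "freq ptrs (\<lambda>a. \<forall>i<t. even (card {e \<in> F. fst (a e) = i})) \<le> (card F / t) ^ h"
  using assms
proof (induction h arbitrary: F)
  case 0
  have "freq ptrs (\<lambda>a. \<forall>i<t. even (card {e \<in> F. fst (a e) = i})) \<le> freq ptrs (\<lambda>_. True)"
    by (intro freq_mono finite_ptrs) auto
  then show ?case
    using card_ptrs_pos by (simp add: freq_def)
next
  case (Suc h)
  let ?even = "\<lambda>F a. \<forall>i<t. even (card {e \<in> F. fst (a e) = i})"
  from Suc.prems obtain e0 where e0: "e0 \<in> F"
    by (cases "F = {}") auto
  have "freq ptrs (?even F)
      \<le> freq ptrs (\<lambda>a. \<exists>e1\<in>F - {e0}. fst (a e0) = fst (a e1) \<and> ?even (F - {e0, e1}) a)"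
  proof (intro freq_mono finite_ptrs)
    fix a assume a: "a \<in> ptrs" and ev: "?even F a"
    have lt: "fst (a e0) < t"
      using ptrs_row[OF a, of e0] e0 Suc.prems by blast
    let ?G = "{e \<in> F. fst (a e) = fst (a e0)}"
    have fin: "finite ?G"
      using Suc.prems by auto
    have "even (card ?G)"
      using ev lt by blast
    moreover have "card {e0} = 1"
      by simp
    ultimately have "?G \<noteq> {e0}"
      by (metis odd_one)
    then obtain e1 where e1: "e1 \<in> F" "e1 \<noteq> e0" "fst (a e1) = fst (a e0)"
      using e0 by blast
    have "?even (F - {e0, e1}) a"
    proof (intro allI impI)
      fix i assume i: "i < t"
      show "even (card {e \<in> F - {e0, e1}. fst (a e) = i})"
      proof (cases "i = fst (a e0)")
        case True
        have "{e \<in> F - {e0, e1}. fst (a e) = i} = ?G - {e0, e1}"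
          using True by auto
        moreover have "card (?G - {e0, e1}) = card ?G - 2"
          using e0 e1 fin by (subst card_Diff_subset) auto
        ultimately show ?thesis
          using ev lt by simp
      next
        case False
        then have "{e \<in> F - {e0, e1}. fst (a e) = i} = {e \<in> F. fst (a e) = i}"
          using e1 by auto
        then show ?thesis
          using ev i by simp
      qed
    qed
    with e1 show "\<exists>e1\<in>F - {e0}. fst (a e0) = fst (a e1) \<and> ?even (F - {e0, e1}) a"
      by (intro bexI[of _ e1]) simp_all
  qed
  also have "\<dots> \<le> (\<Sum>e1\<in>F - {e0}. freq ptrs (\<lambda>a. fst (a e0) = fst (a e1) \<and> ?even (F - {e0, e1}) a))"
    using Suc.prems by (intro freq_Ex_le finite_ptrs) auto
  also have "\<dots> \<le> (\<Sum>e1\<in>F - {e0}. 1 / t * (card F / t) ^ h)"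
  proof (intro sum_mono)
    fix e1 assume e1: "e1 \<in> F - {e0}"
    have "freq ptrs (\<lambda>a. fst (a e0) = fst (a e1) \<and> ?even (F - {e0, e1}) a)
        = freq ptrs (\<lambda>a. fst (a e0) = fst (a e1)) * freq ptrs (?even (F - {e0, e1}))"
      unfolding ptrs_def
    proof (rule freq_indep[where B = "{e0, e1}"])
      fix a v :: pointers
      have "{e \<in> F - {e0, e1}. fst (splice_on {e0, e1} a v e) = i} = {e \<in> F - {e0, e1}. fst (a e) = i}" for i
        by (auto simp: splice_on_def)
      then show "?even (F - {e0, e1}) (splice_on {e0, e1} a v) = ?even (F - {e0, e1}) a"
        by simp
    qed (use finite_idx finite_slots in \<open>auto simp: splice_on_def\<close>)
    also have "freq ptrs (\<lambda>a. fst (a e0) = fst (a e1)) = real D / real (card slots)"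
      unfolding ptrs_def
    proof (rule freq_PiE_pair[where R = "\<lambda>y z. fst y = fst z"])
      fix z assume "z \<in> slots"
      then have "{z' \<in> slots. fst z = fst z'} = {fst z} \<times> {..<D}"
        by (auto simp: slots_def)
      then show "card {z' \<in> slots. fst z = fst z'} = D"
        by simp
    qed (use e0 e1 Suc.prems finite_idx finite_slots slots_ne in auto)
    also have "\<dots> = 1 / t"
      using t_pos D_pos by (simp add: card_slots)
    also have "freq ptrs (?even (F - {e0, e1})) \<le> (card (F - {e0, e1}) / t) ^ h"
      using e0 e1 Suc.prems by (intro Suc.IH) (auto simp: card_Diff_subset)
    also have "\<dots> \<le> (card F / t) ^ h"
      using Suc.prems by (intro power_mono divide_right_mono of_nat_mono card_mono) auto
    finally show "freq ptrs (\<lambda>a. fst (a e0) = fst (a e1) \<and> ?even (F - {e0, e1}) a)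
        \<le> 1 / t * (card F / t) ^ h"
      using t_pos by (simp add: divide_right_mono)
  qed
  also have "\<dots> = card (F - {e0}) / t * (card F / t) ^ h"
    by simp
  also have "\<dots> \<le> card F / t * (card F / t) ^ h"
    using Suc.prems by (intro mult_right_mono divide_right_mono of_nat_mono card_mono) auto
  finally show ?case
    by simp
qed

end

lemma power_self_le_fact: "real n ^ n \<le> 3 ^ n * fact n"
proof (induction n)
  case 0
  then show ?case by simp
next
  case (Suc n)
  show ?case
  proof (cases "n = 0")
    case True
    then show ?thesis by simp
  next
    case False
    have "(1 + 1 / real n) ^ n \<le> exp 1"
      using False by (intro exp_ge_one_plus_x_over_n_power_n) auto
    also have "\<dots> \<le> 3"
      by (rule exp_le)
    finally have "(1 + 1 / real n) ^ n \<le> 3" .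
    then have "(1 + 1 / real n) ^ n * real n ^ n \<le> 3 * (3 ^ n * fact n)"
      using Suc by (intro mult_mono) auto
    also have "(1 + 1 / real n) ^ n * real n ^ n = real (Suc n) ^ n"
      using False by (simp add: field_simps flip: power_mult_distrib)
    finally have "real (Suc n) * real (Suc n) ^ n \<le> real (Suc n) * (3 * (3 ^ n * fact n))"
      by (intro mult_left_mono) auto
    then show ?thesis
      by (simp add: mult_ac)
  qed
qed

text \<open>By the preceding estimate the binomial is at most (96 t / r)^(2 r), with 96 = 3 * 64 /
  2, and 1990656 = 96^2 * 6^3. Three pointers per clause give the exponent 3 r against 2 r, which
  leaves a positive power of r/t.\<close>

lemma choose_mult_power_le:
  assumes "t > 0" "r > 0"
  shows "real ((64 * t) choose (2 * r)) * (real (6 * r) / real t) ^ (3 * r) \<le> (1990656 * real r / real t) ^ r"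
proof -
  have frac: "A ^ n * X ^ n / Y ^ n = (A * X / Y) ^ n" for A X Y :: real and n
    by (simp add: power_mult_distrib power_divide)
  have pos: "0 < (2 * real r) ^ (2 * r)"
    using assms by simp
  have "real ((64 * t) choose (2 * r)) * (2 * real r) ^ (2 * r)
      \<le> real ((64 * t) choose (2 * r)) * (3 ^ (2 * r) * fact (2 * r))"
    using power_self_le_fact[of "2 * r"] by (intro mult_left_mono) (simp_all only: of_nat_mult of_nat_numeral of_nat_0_le_iff)
  also have "\<dots> = 3 ^ (2 * r) * real (((64 * t) choose (2 * r)) * fact (2 * r))"
    by simp
  also have "\<dots> \<le> 3 ^ (2 * r) * real ((64 * t) ^ (2 * r))"
    by (intro mult_left_mono of_nat_mono binomial_fact_pow) auto
  also have "\<dots> = 3 ^ (2 * r) * (64 * real t) ^ (2 * r)"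
    by (simp only: of_nat_power of_nat_mult of_nat_numeral)
  finally have "real ((64 * t) choose (2 * r)) \<le> 3 ^ (2 * r) * (64 * real t) ^ (2 * r) / (2 * real r) ^ (2 * r)"
    using pos by (simp only: pos_le_divide_eq)
  also have "\<dots> = (3 * (64 * real t) / (2 * real r)) ^ (2 * r)"
    by (rule frac)
  finally have "real ((64 * t) choose (2 * r)) * (real (6 * r) / real t) ^ (3 * r)
      \<le> (3 * (64 * real t) / (2 * real r)) ^ (2 * r) * (real (6 * r) / real t) ^ (3 * r)"
    by (intro mult_right_mono) auto
  also have "\<dots> = (3 * (64 * real t) / (2 * real r)) ^ (2 * r) * (6 * real r / real t) ^ (3 * r)"
    by (simp only: of_nat_mult of_nat_numeral)
  also have "\<dots> = ((3 * (64 * real t) / (2 * real r)) ^ 2 * (6 * real r / real t) ^ 3) ^ r"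
    by (simp only: power_mult power_mult_distrib)
  also have "(3 * (64 * real t) / (2 * real r)) ^ 2 * (6 * real r / real t) ^ 3 = 1990656 * real r / real t"
    using assms by (simp add: field_simps power2_eq_square power3_eq_cube)
  finally show ?thesis .
qed

context hidden_pointers
begin

text \<open>The fibres add up to 3 |S|, and 3 is odd. So only sets of even size 2 r enter the union
  bound.\<close>

lemma even_card_if_even_fibres:
  assumes a: "a \<in> ptrs" and S: "S \<subseteq> {..<m}" and ev: "\<forall>i<t. even (card {e \<in> S \<times> {..<3}. fst (a e) = i})"
  shows "even (card S)"
proof -
  have fin: "finite (S \<times> {..<3::nat})"
    using S finite_subset by blast
  have sub: "S \<times> {..<3} \<subseteq> idx"
    using S by (auto simp: idx_def)
  have "S \<times> {..<3} = (\<Union>i<t. {e \<in> S \<times> {..<3}. fst (a e) = i})"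
    using ptrs_row[OF a] sub by fastforce
  then have "card (S \<times> {..<3::nat}) = card (\<Union>i<t. {e \<in> S \<times> {..<3}. fst (a e) = i})"
    by (rule arg_cong)
  also have "\<dots> = (\<Sum>i<t. card {e \<in> S \<times> {..<3}. fst (a e) = i})"
    using fin by (intro card_UN_disjoint) auto
  also have "even \<dots>"
    using ev by (intro dvd_sum) auto
  finally show ?thesis
    by (simp add: card_cartesian_product)
qed

text \<open>Union bound over sets of 2 r clauses, whose 6 r pointers are paired off in 3 r rounds.
  As r is at most t / 40000000 and 1990656 / 40000000 < 1/20, the sum is dominated by a geometric
  series.\<close>

lemma freq_not_cover_free_le:
  assumes m: "m = 64 * t" and K: "K = t div 20000000"
  shows "freq ptrs (\<lambda>a. \<not> cover_free K a) \<le> 1 / 19"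
proof -
  let ?ev = "\<lambda>S a. \<forall>i<t. even (card {e \<in> S \<times> {..<3::nat}. fst (a e) = i})"
  let ?R = "{1..K div 2}"
  let ?SS = "\<lambda>r. {S. S \<subseteq> {..<m} \<and> card S = 2 * r}"
  have "freq ptrs (\<lambda>a. \<not> cover_free K a) \<le> freq ptrs (\<lambda>a. \<exists>r\<in>?R. \<exists>S\<in>?SS r. ?ev S a)"
  proof (intro freq_mono finite_ptrs)
    fix a assume a: "a \<in> ptrs" and "\<not> cover_free K a"
    then obtain S where S: "S \<subseteq> {..<m}" "S \<noteq> {}" "card S \<le> K" "?ev S a"
      unfolding cover_free_def by blast
    have "finite S"
      using S finite_subset by blast
    then have "card S > 0"
      using S by (simp add: card_gt_0_iff)
    moreover obtain r where r: "card S = 2 * r"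
      using even_card_if_even_fibres[OF a S(1,4)] by (elim evenE)
    ultimately have "r \<in> ?R"
      using S by auto
    with S r show "\<exists>r\<in>?R. \<exists>S\<in>?SS r. ?ev S a"
      by blast
  qed
  also have "\<dots> \<le> (\<Sum>r\<in>?R. freq ptrs (\<lambda>a. \<exists>S\<in>?SS r. ?ev S a))"
    by (intro freq_Ex_le finite_ptrs) auto
  also have "\<dots> \<le> (\<Sum>r\<in>?R. (1 / 20) ^ r)"
  proof (intro sum_mono)
    fix r assume r: "r \<in> ?R"
    have "freq ptrs (\<lambda>a. \<exists>S\<in>?SS r. ?ev S a) \<le> (\<Sum>S\<in>?SS r. freq ptrs (?ev S))"
      by (intro freq_Ex_le finite_ptrs) auto
    also have "\<dots> \<le> (\<Sum>S\<in>?SS r. (real (6 * r) / t) ^ (3 * r))"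
    proof (intro sum_mono)
      fix S assume S: "S \<in> ?SS r"
      then have fin: "finite S"
        using finite_subset by blast
      have "freq ptrs (?ev S) \<le> (real (card (S \<times> {..<3::nat})) / t) ^ (3 * r)"
        using S fin by (intro freq_even_fibres_le) (auto simp: idx_def card_cartesian_product)
      then show "freq ptrs (?ev S) \<le> (real (6 * r) / t) ^ (3 * r)"
        using S by (simp add: card_cartesian_product)
    qed
    also have "\<dots> = real (m choose (2 * r)) * (real (6 * r) / t) ^ (3 * r)"
      using n_subsets[of "{..<m}" "2 * r"] by simp
    also have "\<dots> \<le> (1990656 * real r / real t) ^ r"
      unfolding m using r t_pos by (intro choose_mult_power_le) auto
    also have "\<dots> \<le> (1 / 20) ^ r"
    proof (intro power_mono)
      have "2 * r \<le> K"
        using r by auto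
      moreover have "20000000 * K \<le> t"
        unfolding K by simp
      ultimately have "40000000 * real r \<le> real t"
        by linarith
      then show "1990656 * real r / real t \<le> 1 / 20"
        using t_pos by (simp add: field_simps)
    qed simp
    finally show "freq ptrs (\<lambda>a. \<exists>S\<in>?SS r. ?ev S a) \<le> (1 / 20) ^ r" .
  qed
  also have "\<dots> \<le> 1 / 19"
  proof -
    have "(\<Sum>r\<in>{1..n}. (1 / 20 :: real) ^ r) = (1 - (1 / 20) ^ n) / 19" for n :: nat
    proof (induction n)
      case (Suc n)
      have "(1 - y) / 19 + (1 / 20) * y = (1 - (1 / 20) * y) / 19" for y :: real
        by (simp add: field_simps)
      from this[of "(1 / 20) ^ n"] show ?case
        using Suc by simp
    qed simp
    then show ?thesis
      by simp
  qed
  finally show ?thesis .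
qed

section \<open>Expectations under the uniform and the planted distribution\<close>

definition uniform_mass :: "(pointers \<Rightarrow> signs \<Rightarrow> real) \<Rightarrow> real" where
  "uniform_mass f = (\<Sum>a\<in>ptrs. \<Sum>g\<in>sgns. f a g) / (card ptrs * 8 ^ m)"

definition planted_mass :: "(pointers \<Rightarrow> signs \<Rightarrow> real) \<Rightarrow> real" where
  "planted_mass f = (\<Sum>a\<in>ptrs. \<Sum>x\<in>asgs. \<Sum>g\<in>sgns. planted a x g * f a g) / (card ptrs * 2 ^ t * 8 ^ m)"

lemma planted_nonneg: "planted a x g \<ge> 0"
proof -
  have "\<bar>sg b\<bar> = 1" for b
    by (simp add: sg_def)
  then have "\<bar>chi a x g j\<bar> = 1" for j
    by (simp add: chi_def abs_mult abs_prod)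
  then have "chi a x g j + 1 \<ge> 0" for j
    using abs_ge_minus_self[of "chi a x g j"] by simp
  then show ?thesis
    unfolding planted_def by (intro prod_nonneg) simp
qed

lemma uniform_mass_add: "uniform_mass (\<lambda>a g. f a g + h a g) = uniform_mass f + uniform_mass h"
  by (simp add: uniform_mass_def sum.distrib add_divide_distrib)

lemma planted_mass_add: "planted_mass (\<lambda>a g. f a g + h a g) = planted_mass f + planted_mass h"
  by (simp add: planted_mass_def sum.distrib add_divide_distrib distrib_left)

lemma uniform_mass_mono:
  assumes "\<And>a g. a \<in> ptrs \<Longrightarrow> g \<in> sgns \<Longrightarrow> f a g \<le> h a g"
  shows "uniform_mass f \<le> uniform_mass h"
  unfolding uniform_mass_def using assms by (intro divide_right_mono sum_mono) auto

lemma planted_mass_mono: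
  assumes "\<And>a g. a \<in> ptrs \<Longrightarrow> g \<in> sgns \<Longrightarrow> f a g \<le> h a g"
  shows "planted_mass f \<le> planted_mass h"
  unfolding planted_mass_def using assms planted_nonneg
  by (intro divide_right_mono sum_mono mult_left_mono) auto

lemma planted_mass_const: "planted_mass (\<lambda>a g. of_bool (P a)) = freq ptrs P"
proof -
  have eq: "(\<Sum>x\<in>asgs. \<Sum>g\<in>sgns. planted a x g * of_bool (P a)) = of_bool (P a) * (2 ^ t * 8 ^ m)" for a
    by (cases "P a") (simp_all add: sum_planted_const)
  then show ?thesis
    unfolding planted_mass_def freq_sum[OF finite_ptrs] eq
    by (simp flip: sum_distrib_right)
qed

lemma uniform_mass_touched_le:
  assumes "t * D \<ge> 6"
    and "\<And>a g. a \<in> ptrs \<Longrightarrow> g \<in> sgns \<Longrightarrow> real (num_queries T (inst a g)) \<le> q"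
  shows "uniform_mass (\<lambda>a g. of_bool (K < card (touched T a g))) \<le> 24 * q / (t * D * Suc K)"
proof -
  have "uniform_mass (\<lambda>a g. of_bool (K < card (touched T a g)))
      \<le> uniform_mass (\<lambda>a g. card (touched T a g) / Suc K)"
    by (intro uniform_mass_mono) (auto simp: field_simps)
  also have "\<dots> = (\<Sum>g\<in>sgns. \<Sum>a\<in>ptrs. card (touched T a g)) / (card ptrs * 8 ^ m) / Suc K"
    by (subst sum.swap) (simp add: uniform_mass_def sum_divide_distrib mult_ac)
  also have "\<dots> \<le> (\<Sum>g\<in>sgns. 24 * q / (t * D) * card ptrs) / (card ptrs * 8 ^ m) / Suc K"
  proof (intro divide_right_mono)
    have "(\<Sum>g\<in>sgns. \<Sum>a\<in>ptrs. real (card (touched T a g))) \<le> (\<Sum>g\<in>sgns. 24 * q / (t * D) * card ptrs)"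
      using assms by (intro sum_mono sum_card_touched_le) auto
    then show "real (\<Sum>g\<in>sgns. \<Sum>a\<in>ptrs. card (touched T a g)) \<le> (\<Sum>g\<in>sgns. 24 * q / (t * D) * card ptrs)"
      by simp
  qed auto
  also have "\<dots> = 24 * q / (t * D * Suc K)"
    using card_ptrs_pos by (simp add: card_sgns algebra_simps)
  finally show ?thesis .
qed

text \<open>The number of touched clauses is bounded directly only under the uniform distribution,
  where the pointers stay uniform for fixed signs. The bound is transferred by complement:
  cover-free pointers have equal mass on both sides, and so do those among them with at most
  \<open>K\<close> touched clauses, hence also those with more.\<close>

lemma planted_mass_run_le:
  assumes m: "m = 64 * t" and K: "K = t div 20000000" and large: "t * D \<ge> 6"
    and q: "\<And>a g. a \<in> ptrs \<Longrightarrow> g \<in> sgns \<Longrightarrow> real (num_queries T (inst a g)) \<le> q"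
  shows "planted_mass (\<lambda>a g. of_bool (P (run T (inst a g))))
    \<le> uniform_mass (\<lambda>a g. of_bool (P (run T (inst a g)))) + 1 / 19 + 24 * q / (t * D * Suc K)"
proof -
  let ?good = "\<lambda>P a g. of_bool (cover_free K a) * of_bool (P (run T (inst a g)) \<and> card (touched T a g) \<le> K)"
  have eq: "planted_mass (?good P) = uniform_mass (?good P)" for P
  proof -
    have "(\<Sum>x\<in>asgs. \<Sum>g\<in>sgns. planted a x g * ?good P a g) = 2 ^ t * (\<Sum>g\<in>sgns. ?good P a g)" for a
      using sum_planted_run[of K a P T] by (cases "cover_free K a") auto
    then show ?thesis
      unfolding planted_mass_def uniform_mass_def by (simp add: sum_distrib_left[symmetric])
  qed
  have tot: "planted_mass (\<lambda>a g. of_bool (cover_free K a)) = uniform_mass (\<lambda>a g. of_bool (cover_free K a))"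
    unfolding planted_mass_const unfolding uniform_mass_def freq_sum[OF finite_ptrs]
    by (simp add: card_sgns sum_distrib_left[symmetric])
  let ?many = "\<lambda>a g. of_bool (cover_free K a) * of_bool (K < card (touched T a g))"
  have split: "of_bool (cover_free K a) = ?good (\<lambda>_. True) a g + (?many a g :: real)" for a g
    by auto
  have many: "planted_mass ?many = uniform_mass ?many"
  proof -
    have "planted_mass (\<lambda>a g. ?good (\<lambda>_. True) a g + ?many a g)
        = uniform_mass (\<lambda>a g. ?good (\<lambda>_. True) a g + ?many a g)"
      unfolding split[symmetric] by (rule tot)
    then show ?thesis
      unfolding planted_mass_add uniform_mass_add eq[of "\<lambda>_. True"] by simp
  qed
  have "planted_mass (\<lambda>a g. of_bool (P (run T (inst a g))))
      \<le> planted_mass (\<lambda>a g. (?good P a g + ?many a g) + of_bool (\<not> cover_free K a))"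
    by (intro planted_mass_mono) auto
  also have "\<dots> = uniform_mass (?good P) + uniform_mass ?many + freq ptrs (\<lambda>a. \<not> cover_free K a)"
    by (simp only: planted_mass_add eq many planted_mass_const)
  also have "uniform_mass (?good P) \<le> uniform_mass (\<lambda>a g. of_bool (P (run T (inst a g))))"
    by (intro uniform_mass_mono) auto
  also have "uniform_mass ?many \<le> uniform_mass (\<lambda>a g. of_bool (K < card (touched T a g)))"
    by (intro uniform_mass_mono) auto
  also have "\<dots> \<le> 24 * q / (t * D * Suc K)"
    using assms by (intro uniform_mass_touched_le) auto
  also have "freq ptrs (\<lambda>a. \<not> cover_free K a) \<le> 1 / 19"
    by (rule freq_not_cover_free_le[OF m K])
  finally show ?thesis
    by simp
qed

end

section \<open>Tours of (1,2)-metrics\<close>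

definition adj_matrix :: "nat \<Rightarrow> (nat \<Rightarrow> nat \<Rightarrow> bool) \<Rightarrow> nat \<Rightarrow> nat \<Rightarrow> nat" where
  "adj_matrix n E u v = (if u < n \<and> v < n \<and> u \<noteq> v then if E u v then 1 else 2 else 0)"

lemma adj_matrix_onetwo:
  assumes "\<And>u v. E u v = E v u"
  shows "adj_matrix n E \<in> onetwo_instances n"
  using assms by (auto simp: onetwo_instances_def adj_matrix_def)

text \<open>Nonadjacent vertices have the common neighbour \<open>w\<close>, so no distance exceeds
  2.\<close>

lemma adj_matrix_graphic:
  assumes sym: "\<And>u v. E u v = E v u" and w: "w < n" "\<And>v. v < n \<Longrightarrow> v \<noteq> w \<Longrightarrow> E v w"
  shows "adj_matrix n E \<in> graphic_instances n"
proof -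
  define E' where "E' u v \<longleftrightarrow> u < n \<and> v < n \<and> u \<noteq> v \<and> E u v" for u v
  define Q where "Q u v k \<longleftrightarrow> (\<exists>xs. walk E' xs \<and> hd xs = u \<and> last xs = v \<and> length xs = Suc k)" for u v k
  have simple: "simple_graph n E'"
    using sym by (auto simp: simple_graph_def E'_def)
  have Q0: "Q u v 0 \<longleftrightarrow> u = v" for u v
    unfolding Q_def walk_def length_Suc_conv by (auto intro!: exI[of _ "[v]"])
  have Q1: "Q u v (Suc 0) \<longleftrightarrow> E' u v" for u v
    unfolding Q_def walk_def length_Suc_conv by (auto intro!: exI[of _ "[u, v]"])
  have Q2: "Q u v 2" if "u < n" "v < n" "u \<noteq> v" "\<not> E u v" for u v
  proof -
    have "v \<noteq> w" "u \<noteq> w"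
      using that w sym by metis+
    then have "E' u w" "E' w v"
      using that w sym by (auto simp: E'_def)
    then have "walk E' [u, w, v]"
      by (auto simp: walk_def nth_Cons split: nat.splits)
    then show ?thesis
      unfolding Q_def by (intro exI[of _ "[u, w, v]"]) auto
  qed
  have "connected_graph n E'"
    unfolding connected_graph_def
  proof (intro allI impI)
    fix u v assume uv: "u < n" "v < n"
    have "Q u v 0 \<or> Q u v (Suc 0) \<or> Q u v 2"
      using uv Q0[of u v] Q1[of u v] Q2[of u v] by (auto simp: E'_def)
    then show "\<exists>xs. walk E' xs \<and> hd xs = u \<and> last xs = v"
      unfolding Q_def by blast
  qed
  moreover have "graph_dist n E' u v = adj_matrix n E u v" for u v
  proof (cases "u < n \<and> v < n")
    case False
    then show ?thesis
      by (auto simp: graph_dist_def adj_matrix_def)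
  next
    case True
    have "(LEAST k. Q u v k) = adj_matrix n E u v"
    proof (rule Least_equality)
      show "Q u v (adj_matrix n E u v)"
        using True Q0[of u v] Q1[of u v] Q2[of u v] by (auto simp: adj_matrix_def E'_def)
      fix k assume k: "Q u v k"
      show "adj_matrix n E u v \<le> k"
      proof (rule ccontr)
        assume "\<not> adj_matrix n E u v \<le> k"
        then have "k < adj_matrix n E u v"
          by simp
        then have "k = 0 \<and> u \<noteq> v \<or> k = Suc 0 \<and> \<not> E' u v"
          using True by (auto simp: adj_matrix_def E'_def less_2_cases_iff split: if_splits)
        then show False
          using k Q0 Q1 by auto
      qed
    qed
    then show ?thesis
      using True by (simp add: graph_dist_def Q_def)
  qed
  then have "graph_dist n E' = adj_matrix n E"
    by (intro ext)
  ultimately show ?thesis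
    using simple unfolding graphic_instances_def by (intro CollectI exI[of _ E']) simp
qed

lemma Suc_mod_ne: "i < n \<Longrightarrow> 2 \<le> n \<Longrightarrow> Suc i mod n \<noteq> i"
  by (cases "Suc i = n") auto

lemma tour_cost_adj_matrix:
  assumes p: "p permutes {0..<n}" and n: "2 \<le> n"
  shows "tour_cost n (adj_matrix n E) p = n + card {i. i < n \<and> \<not> E (p i) (p (Suc i mod n))}"
proof -
  have "adj_matrix n E (p i) (p (Suc i mod n)) = 1 + (if E (p i) (p (Suc i mod n)) then 0 else 1)"
    if "i < n" for i
  proof -
    have "p i < n" "p (Suc i mod n) < n"
      using permutes_in_image[OF p] that n by auto
    moreover have "p i \<noteq> p (Suc i mod n)"
      using Suc_mod_ne[OF that n] permutes_inj[OF p] by (metis injD)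
    ultimately show ?thesis
      by (simp add: adj_matrix_def)
  qed
  then have "tour_cost n (adj_matrix n E) p = (\<Sum>i<n. 1 + (if E (p i) (p (Suc i mod n)) then 0 else 1))"
    unfolding tour_cost_def by (intro sum.cong) auto
  also have "\<dots> = n + card {i. i < n \<and> \<not> E (p i) (p (Suc i mod n))}"
    by (subst sum.distrib) (auto simp: sum.If_cases intro!: arg_cong[where f = card])
  finally show ?thesis .
qed

lemma finite_tours: "finite {tour_cost n d p | p. p permutes {0..<n}}"
proof -
  have "{tour_cost n d p | p. p permutes {0..<n}} = tour_cost n d ` {p. p permutes {0..<n}}"
    by auto
  then show ?thesis
    by (simp add: finite_permutations)
qed

lemma tsp_cost_le: "p permutes {0..<n} \<Longrightarrow> tsp_cost n d \<le> tour_cost n d p"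
  unfolding tsp_cost_def by (intro Min_le finite_tours) auto

lemma tsp_cost_attained: "\<exists>p. p permutes {0..<n} \<and> tsp_cost n d = tour_cost n d p"
proof -
  have "tsp_cost n d \<in> {tour_cost n d p | p. p permutes {0..<n}}"
    unfolding tsp_cost_def using permutes_id by (intro Min_in finite_tours) blast
  then show ?thesis
    by auto
qed

text \<open>In the cyclic order \<open>ys @ zs\<close> only the step leaving \<open>ys\<close> and
  the steps leaving the elements of \<open>zs\<close>, including the closing one, can be
  nonadjacent.\<close>

lemma tsp_cost_le_of_list:
  assumes dec: "bij_betw dec {..<n} V" and n: "2 \<le> n"
    and xs: "distinct (ys @ zs)" "set (ys @ zs) = V" "successively adj ys"
  shows "tsp_cost n (adj_matrix n (\<lambda>u v. adj (dec u) (dec v))) \<le> n + length zs + 1"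
proof -
  let ?xs = "ys @ zs"
  let ?E = "\<lambda>u v. adj (dec u) (dec v)"
  define enc where "enc = inv_into {..<n} dec"
  define p where "p i = (if i < n then enc (?xs ! i) else i)" for i
  have len: "length ?xs = n"
    using xs bij_betw_same_card[OF dec] distinct_card[of ?xs] by simp
  have enc: "bij_betw enc V {..<n}"
    unfolding enc_def by (rule bij_betw_inv_into[OF dec])
  have "bij_betw (\<lambda>i. ?xs ! i) {..<n} V"
    using bij_betw_nth[OF xs(1), of "{..<n}" V] len xs(2) by simp
  then have "bij_betw (enc \<circ> (\<lambda>i. ?xs ! i)) {..<n} {..<n}"
    using enc by (rule bij_betw_trans)
  then have "bij_betw p {0..<n} {0..<n}"
    by (subst bij_betw_cong[where g = "enc \<circ> (\<lambda>i. ?xs ! i)"]) (auto simp: p_def lessThan_atLeast0)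
  then have p: "p permutes {0..<n}"
    by (rule bij_imp_permutes) (simp add: p_def)
  have decp: "dec (p i) = ?xs ! i" if "i < n" for i
  proof -
    have "?xs ! i \<in> V"
      using that len xs(2) nth_mem by metis
    then show ?thesis
      using that dec by (simp add: p_def enc_def bij_betw_def f_inv_into_f)
  qed
  have "{i. i < n \<and> \<not> ?E (p i) (p (Suc i mod n))} \<subseteq> {length ys - 1..<n}"
  proof
    fix i assume "i \<in> {i. i < n \<and> \<not> ?E (p i) (p (Suc i mod n))}"
    then have i: "i < n" "\<not> ?E (p i) (p (Suc i mod n))"
      by auto
    have "\<not> Suc i < length ys"
    proof
      assume lt: "Suc i < length ys"
      then have "Suc i mod n = Suc i"
        using len by simp
      then have "\<not> adj (ys ! i) (ys ! Suc i)"
        using i lt len decp[of i] decp[of "Suc i"] by (simp add: nth_append)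
      moreover have "adj (ys ! i) (ys ! Suc i)"
        using xs(3) lt by (simp add: successively_conv_nth)
      ultimately show False by simp
    qed
    then show "i \<in> {length ys - 1..<n}"
      using i by auto
  qed
  then have "card {i. i < n \<and> \<not> ?E (p i) (p (Suc i mod n))} \<le> card {length ys - 1..<n}"
    by (intro card_mono) auto
  also have "\<dots> \<le> length zs + 1"
    using len by simp
  finally show ?thesis
    using tsp_cost_le[OF p, of "adj_matrix n ?E"] tour_cost_adj_matrix[OF p n, of ?E] by simp
qed

section \<open>Tours as connected 2-regular relations\<close>

text \<open>The neighbour relation \<open>nb\<close> of a cyclic ordering of \<open>V\<close>.\<close>

locale cyclic_nbrs =
  fixes V :: "'v set" and nb :: "'v \<Rightarrow> 'v \<Rightarrow> bool"
  assumes finV: "finite V"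
    and nb_sym: "nb v u \<Longrightarrow> nb u v"
    and nb_in: "nb v u \<Longrightarrow> v \<in> V"
    and card_nb: "v \<in> V \<Longrightarrow> card {u. nb v u} = 2"
    and nb_closed: "C \<subseteq> V \<Longrightarrow> C \<noteq> {} \<Longrightarrow> (\<And>v u. v \<in> C \<Longrightarrow> nb v u \<Longrightarrow> u \<in> C) \<Longrightarrow> C = V"

lemma cyclic_nbrs_of_enum:
  fixes w :: "nat \<Rightarrow> 'v"
  assumes w: "bij_betw w {..<n} V" and n: "3 \<le> n"
  shows "cyclic_nbrs V (\<lambda>v u. \<exists>i<n. (v = w i \<and> u = w (Suc i mod n)) \<or> (u = w i \<and> v = w (Suc i mod n)))"
    (is "cyclic_nbrs V ?nb")
proof
  have inj: "w i = w j \<longleftrightarrow> i = j" if "i < n" "j < n" for i j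
    using w that by (auto simp: bij_betw_def inj_on_def)
  have mod_lt: "Suc i mod n < n" for i
    using n by simp
  have V: "V = w ` {..<n}"
    using w by (simp add: bij_betw_def)
  show "finite V"
    by (simp add: V)
  show "?nb v u \<Longrightarrow> ?nb u v" for v u
    by blast
  show "?nb v u \<Longrightarrow> v \<in> V" for v u
    using mod_lt by (auto simp: V)
  show "card {u. ?nb v u} = 2" if "v \<in> V" for v
  proof -
    obtain i where i: "i < n" "v = w i"
      using \<open>v \<in> V\<close> by (auto simp: V)
    define j where "j = (if i = 0 then n - 1 else i - 1)"
    have j: "j < n" "Suc j mod n = i" "j \<noteq> Suc i mod n"
      using i n by (auto simp: j_def mod_Suc)
    have uniq: "k = j" if "k < n" "Suc k mod n = i" for k
      using that n by (auto simp: j_def mod_Suc split: if_splits)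
    have "{u. ?nb v u} = {w (Suc i mod n), w j}"
    proof (intro equalityI subsetI)
      fix u assume "u \<in> {u. ?nb v u}"
      then obtain k where k: "k < n" "(w i = w k \<and> u = w (Suc k mod n)) \<or> (u = w k \<and> w i = w (Suc k mod n))"
        using i by auto
      then show "u \<in> {w (Suc i mod n), w j}"
        using inj[OF i(1) k(1)] inj[OF i(1) mod_lt[of k]] uniq by auto
    next
      fix u assume "u \<in> {w (Suc i mod n), w j}"
      then show "u \<in> {u. ?nb v u}"
        using i j by auto
    qed
    moreover have "w (Suc i mod n) \<noteq> w j"
      using j inj mod_lt by metis
    ultimately show ?thesis
      by simp
  qed
  show "C = V" if C: "C \<subseteq> V" "C \<noteq> {}" and closed: "\<And>v u. v \<in> C \<Longrightarrow> ?nb v u \<Longrightarrow> u \<in> C" for C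
  proof -
    obtain i where i: "i < n" "w i \<in> C"
      using C by (auto simp: V)
    have "w ((i + k) mod n) \<in> C" for k
    proof (induction k)
      case 0
      then show ?case using i by simp
    next
      case (Suc k)
      have "?nb (w ((i + k) mod n)) (w (Suc ((i + k) mod n) mod n))"
        using n by (intro exI[of _ "(i + k) mod n"]) auto
      then have "w (Suc ((i + k) mod n) mod n) \<in> C"
        using Suc closed by blast
      then show ?case
        by (simp add: mod_Suc_eq)
    qed
    from this[of "_ + (n - i)"] have "w ((j + n) mod n) \<in> C" for j
      using i by (metis add.commute add.left_commute le_add_diff_inverse2 less_imp_le)
    then have "w j \<in> C" if "j < n" for j
      using that by (metis mod_add_self2 mod_less)
    then show ?thesis
      using C by (auto simp: V)
  qed
qed

context cyclic_nbrs
begin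

text \<open>Apex neighbours are excluded because they are adjacent to everything and would allow
  detours that cost nothing.\<close>

definition sat :: "('v \<Rightarrow> 'v \<Rightarrow> bool) \<Rightarrow> ('v \<Rightarrow> bool) \<Rightarrow> 'v \<Rightarrow> bool" where
  "sat adj apex v \<longleftrightarrow> (\<forall>u. nb v u \<longrightarrow> adj v u \<and> \<not> apex u)"

lemma finite_nb: "finite {u. nb v u}"
  using finV nb_in nb_sym by (metis (mono_tags, lifting) mem_Collect_eq rev_finite_subset subsetI)

text \<open>Two candidates for two neighbours must both occur; in the next lemma, two known
  neighbours exhaust the set. All forcing inside ladders rests on these two facts.\<close>

lemma nb_eq_pair:
  assumes "v \<in> V" "\<And>u. nb v u \<Longrightarrow> u = x \<or> u = y"
  shows "nb v u \<longleftrightarrow> u = x \<or> u = y"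
proof -
  have sub: "{u. nb v u} \<subseteq> {x, y}"
    using assms(2) by auto
  moreover have "card {x, y} \<le> card {u. nb v u}"
    unfolding card_nb[OF assms(1)] by (simp add: card_insert_if)
  ultimately have "{u. nb v u} = {x, y}"
    by (intro card_seteq) auto
  then show ?thesis
    by blast
qed

lemma nb_eq_pair':
  assumes "nb v x" "nb v y" "x \<noteq> y"
  shows "nb v u \<longleftrightarrow> u = x \<or> u = y"
proof -
  have "{x, y} = {u. nb v u}"
    using assms finite_nb card_nb[OF nb_in[OF assms(1)]] by (intro card_seteq) auto
  then show ?thesis
    by blast
qed

lemma ex_nb: "v \<in> V \<Longrightarrow> \<exists>u. nb v u"
  using card_nb[of v] by (metis Collect_empty_eq card.empty zero_neq_numeral)

end

text \<open>A nonadjacent step spoils its two endpoints, and an apex vertex spoils its two tour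
  neighbours.\<close>

lemma (in cyclic_nbrs) card_unsat_le:
  assumes w: "bij_betw w {..<n} V"
    and nb: "\<And>v u. nb v u \<longleftrightarrow> (\<exists>i<n. (v = w i \<and> u = w (Suc i mod n)) \<or> (u = w i \<and> v = w (Suc i mod n)))"
    and sym: "\<And>u v. adj u v = adj v u" and "n > 0"
  shows "card {v \<in> V. \<not> sat adj apex v}
    \<le> 2 * card {i. i < n \<and> \<not> adj (w i) (w (Suc i mod n))} + 2 * card {v \<in> V. apex v}"
proof -
  let ?B = "{i. i < n \<and> \<not> adj (w i) (w (Suc i mod n))}"
  let ?U = "{v \<in> V. apex v}"
  have "{v \<in> V. \<not> sat adj apex v} \<subseteq> w ` ?B \<union> (\<lambda>i. w (Suc i mod n)) ` ?B \<union> (\<Union>v\<in>?U. {u. nb v u})"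
  proof
    fix v assume "v \<in> {v \<in> V. \<not> sat adj apex v}"
    then obtain u where u: "nb v u" "\<not> adj v u \<or> apex u"
      by (auto simp: sat_def)
    show "v \<in> w ` ?B \<union> (\<lambda>i. w (Suc i mod n)) ` ?B \<union> (\<Union>v\<in>?U. {u. nb v u})"
    proof (cases "apex u")
      case True
      then show ?thesis
        using u nb_sym nb_in by blast
    next
      case False
      then have "\<not> adj v u"
        using u by simp
      then show ?thesis
        using u(1) unfolding nb sym[of v u] using sym by blast
    qed
  qed
  moreover have "finite (w ` ?B \<union> (\<lambda>i. w (Suc i mod n)) ` ?B \<union> (\<Union>v\<in>?U. {u. nb v u}))"
    using finV finite_nb by auto
  ultimately have "card {v \<in> V. \<not> sat adj apex v}
      \<le> card (w ` ?B \<union> (\<lambda>i. w (Suc i mod n)) ` ?B \<union> (\<Union>v\<in>?U. {u. nb v u}))"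
    by (intro card_mono)
  also have "\<dots> \<le> card (w ` ?B) + card ((\<lambda>i. w (Suc i mod n)) ` ?B) + card (\<Union>v\<in>?U. {u. nb v u})"
    by (intro order_trans[OF card_Un_le] add_mono card_Un_le order_refl)
  also have "\<dots> \<le> card ?B + card ?B + (\<Sum>v\<in>?U. card {u. nb v u})"
    using finV by (intro add_mono card_image_le card_UN_le) auto
  also have "(\<Sum>v\<in>?U. card {u. nb v u}) = 2 * card ?U"
    by (simp add: card_nb)
  finally show ?thesis
    by simp
qed

section \<open>Ladder graphs\<close>

datatype vtx = VP nat nat | VM nat nat | VQ nat nat | VC nat | VU nat

text \<open>Pointer \<open>(j, s)\<close> attaches clause \<open>j\<close> to a pair of consecutive columns of its row; the parity of
  the first column of the pair encodes the sign.\<close>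

definition attach :: "pointers \<Rightarrow> signs \<Rightarrow> nat \<Rightarrow> nat \<Rightarrow> nat \<Rightarrow> bool" where
  "attach a g j i k \<longleftrightarrow> (\<exists>s<3. \<exists>z. a (j, s) = (i, z) \<and>
     (if sel (g j) s then k = 6 * z + 2 \<or> k = 6 * z + 3 else k = 6 * z + 5 \<or> k = 6 * z + 6))"

text \<open>Row \<open>i\<close> is a ladder with rails \<open>VP i k\<close>, \<open>VQ i k\<close> whose rungs are subdivided by \<open>VM i k\<close>. The
  rail ends of all rows are pairwise adjacent, and the vertices \<open>VU r\<close> are adjacent to everything.\<close>

fun arc :: "nat \<Rightarrow> pointers \<Rightarrow> signs \<Rightarrow> vtx \<Rightarrow> vtx \<Rightarrow> bool" where
  "arc l a g (VP i k) (VP i' k') \<longleftrightarrow> i = i' \<and> k' = Suc k \<or> k \<in> {0, l} \<and> k' \<in> {0, l}"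
| "arc l a g (VP i k) (VQ i' k') \<longleftrightarrow> k \<in> {0, l} \<and> k' \<in> {0, l}"
| "arc l a g (VQ i k) (VQ i' k') \<longleftrightarrow> i = i' \<and> k' = Suc k \<or> k \<in> {0, l} \<and> k' \<in> {0, l}"
| "arc l a g (VP i k) (VM i' k') \<longleftrightarrow> i = i' \<and> k = k'"
| "arc l a g (VM i k) (VQ i' k') \<longleftrightarrow> i = i' \<and> k = k'"
| "arc l a g (VC j) (VP i k) \<longleftrightarrow> attach a g j i k"
| "arc l a g (VU r) v \<longleftrightarrow> True"
| "arc l a g _ _ \<longleftrightarrow> False"

definition vadj :: "nat \<Rightarrow> pointers \<Rightarrow> signs \<Rightarrow> vtx \<Rightarrow> vtx \<Rightarrow> bool" where
  "vadj l a g u v \<longleftrightarrow> arc l a g u v \<or> arc l a g v u"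

fun apex :: "vtx \<Rightarrow> bool" where
  "apex (VU r) \<longleftrightarrow> True"
| "apex _ \<longleftrightarrow> False"

fun vrow :: "vtx \<Rightarrow> nat" where
  "vrow (VP i k) = i"
| "vrow (VM i k) = i"
| "vrow (VQ i k) = i"
| "vrow _ = undefined"

definition verts :: "nat \<Rightarrow> nat \<Rightarrow> nat \<Rightarrow> nat \<Rightarrow> vtx set" where
  "verts t l m r = (\<lambda>(i, k). VP i k) ` ({..<t} \<times> {..l}) \<union> (\<lambda>(i, k). VM i k) ` ({..<t} \<times> {..l})
    \<union> (\<lambda>(i, k). VQ i k) ` ({..<t} \<times> {..l}) \<union> VC ` {..<m} \<union> VU ` {..<r}"

lemma vadj_sym: "vadj l a g u v = vadj l a g v u"
  by (auto simp: vadj_def)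

lemma vadj_apex: "vadj l a g v (VU r)"
  by (simp add: vadj_def)

lemma in_verts [simp]:
  "VP i k \<in> verts t l m r \<longleftrightarrow> i < t \<and> k \<le> l"
  "VM i k \<in> verts t l m r \<longleftrightarrow> i < t \<and> k \<le> l"
  "VQ i k \<in> verts t l m r \<longleftrightarrow> i < t \<and> k \<le> l"
  "VC j \<in> verts t l m r \<longleftrightarrow> j < m"
  "VU j \<in> verts t l m r \<longleftrightarrow> j < r"
  by (auto simp: verts_def)

lemma finite_verts: "finite (verts t l m r)"
  by (auto simp: verts_def)

lemma card_verts: "card (verts t l m r) = 3 * (t * Suc l) + m + r"
proof -
  have "card ((\<lambda>(i, k). VP i k) ` ({..<t} \<times> {..l})) = t * Suc l"
    "card ((\<lambda>(i, k). VM i k) ` ({..<t} \<times> {..l})) = t * Suc l"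
    "card ((\<lambda>(i, k). VQ i k) ` ({..<t} \<times> {..l})) = t * Suc l"
    by (subst card_image; auto simp: inj_on_def)+
  moreover have "card (VC ` {..<m}) = m" "card (VU ` {..<r}) = r"
    by (subst card_image; auto simp: inj_on_def)+
  ultimately show ?thesis
    unfolding verts_def by (subst card_Un_disjoint; auto)+
qed

lemma vadj_VM: "vadj l a g (VM i k) u \<Longrightarrow> \<not> apex u \<Longrightarrow> u = VP i k \<or> u = VQ i k"
  by (cases u) (auto simp: vadj_def)

lemma vadj_VQ:
  assumes "vadj l a g (VQ i k) u" "\<not> apex u" "0 < k" "k < l"
  shows "u = VM i k \<or> u = VQ i (k - 1) \<or> u = VQ i (Suc k)"
  using assms by (cases u) (auto simp: vadj_def)

lemma vadj_VP:
  assumes "vadj l a g (VP i k) u" "\<not> apex u" "0 < k" "k < l"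
  shows "u = VM i k \<or> u = VP i (k - 1) \<or> u = VP i (Suc k) \<or> (\<exists>j. u = VC j \<and> attach a g j i k)"
  using assms by (cases u) (auto simp: vadj_def)

lemma vadj_VC:
  assumes "vadj l a g (VC j) u" "\<not> apex u"
  shows "\<exists>i k. u = VP i k \<and> attach a g j i k"
  using assms by (cases u) (auto simp: vadj_def)

text \<open>Columns 1 and 4 modulo 6 are clause-free buffers on either side of each attached
  pair.\<close>

lemma attach_mod:
  assumes "attach a g j i k"
  shows "k mod 6 \<noteq> 1 \<and> k mod 6 \<noteq> 4"
proof -
  obtain z c where "k = 6 * z + c" "c \<in> {2, 3, 5, 6}"
    using assms unfolding attach_def by (metis insertCI)
  then show ?thesis
    by (auto simp only: mod_mult_self4 insert_iff empty_iff) simp_all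
qed

section \<open>Rigidity of undisturbed rows\<close>

locale ladder_tour = cyclic_nbrs "verts t l m r" nb
  for t l m r :: nat and nb +
  fixes a :: pointers and g :: signs and D :: nat
  assumes l: "l = 6 * D + 2" and D_pos: "D > 0" and t_pos: "t > 0"
    and ptr: "\<And>j s. j < m \<Longrightarrow> s < 3 \<Longrightarrow> fst (a (j, s)) < t \<and> snd (a (j, s)) < D"
begin

abbreviation "saturated \<equiv> sat (vadj l a g) apex"

definition clean :: "nat \<Rightarrow> bool" where
  "clean i \<longleftrightarrow> (\<forall>k\<le>l. saturated (VP i k) \<and> saturated (VM i k) \<and> saturated (VQ i k))"

text \<open>The \<open>VQ\<close> rail carries no clauses, so it alternates rigidly along a clean
  row and a single edge reveals the direction of traversal.\<close>

definition decode :: "nat \<Rightarrow> bool" where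
  "decode i \<longleftrightarrow> nb (VQ i 1) (VQ i 2)"

lemma nb_saturated: "saturated v \<Longrightarrow> nb v u \<Longrightarrow> vadj l a g v u \<and> \<not> apex u"
  by (simp add: sat_def)

context
  fixes i
  assumes i: "i < t" and clean: "clean i"
begin

lemma sat_row: "k \<le> l \<Longrightarrow> saturated (VP i k)" "k \<le> l \<Longrightarrow> saturated (VM i k)" "k \<le> l \<Longrightarrow> saturated (VQ i k)"
  using clean by (auto simp: clean_def)

text \<open>This is why rungs are subdivided: the midpoint has no other non-apex neighbours, so
  every rung must be used.\<close>

lemma rung: "k \<le> l \<Longrightarrow> nb (VM i k) (VP i k)" "k \<le> l \<Longrightarrow> nb (VM i k) (VQ i k)"
proof -
  assume k: "k \<le> l"
  have "nb (VM i k) u \<longleftrightarrow> u = VP i k \<or> u = VQ i k" for u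
    using k i nb_saturated[OF sat_row(2)[OF k]] by (intro nb_eq_pair) (auto dest: vadj_VM)
  then show "nb (VM i k) (VP i k)" "nb (VM i k) (VQ i k)"
    by blast+
qed

lemma rail_Q:
  assumes k: "Suc k < l"
  shows "nb (VQ i (Suc k)) (VQ i (Suc (Suc k))) \<longleftrightarrow> \<not> nb (VQ i k) (VQ i (Suc k))"
proof -
  let ?v = "VQ i (Suc k)"
  have v: "?v \<in> verts t l m r"
    using i k by simp
  have m: "nb ?v (VM i (Suc k))"
    using rung(2)[of "Suc k"] k nb_sym by simp
  have sub: "u = VM i (Suc k) \<or> u = VQ i k \<or> u = VQ i (Suc (Suc k))" if "nb ?v u" for u
    using nb_saturated[OF sat_row(3) that] vadj_VQ[of l a g i "Suc k" u] k by auto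
  show ?thesis
  proof
    assume "nb ?v (VQ i (Suc (Suc k)))"
    then have "nb ?v (VQ i k) \<longleftrightarrow> VQ i k = VM i (Suc k) \<or> VQ i k = VQ i (Suc (Suc k))"
      using m by (intro nb_eq_pair') auto
    then have "\<not> nb ?v (VQ i k)"
      by simp
    then show "\<not> nb (VQ i k) ?v"
      using nb_sym by blast
  next
    assume "\<not> nb (VQ i k) ?v"
    then have "\<not> nb ?v (VQ i k)"
      using nb_sym by blast
    then have "nb ?v u \<longleftrightarrow> u = VM i (Suc k) \<or> u = VQ i (Suc (Suc k))" for u
      using sub by (intro nb_eq_pair v) blast
    then show "nb ?v (VQ i (Suc (Suc k)))"
      by blast
  qed
qed

lemma rail_Q_iff: "k < l \<Longrightarrow> nb (VQ i k) (VQ i (Suc k)) \<longleftrightarrow> (decode i \<longleftrightarrow> odd k)"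
proof (induction k)
  case 0
  then show ?case
    using rail_Q[of 0] l D_pos by (auto simp: decode_def numeral_2_eq_2)
next
  case (Suc k)
  then show ?case
    using rail_Q[of k] by auto
qed

text \<open>Both rails cannot be used between two columns: together with the rungs this closes a cycle of
  length 6.\<close>

lemma not_both_rails:
  assumes k: "k < l" and Q: "nb (VQ i k) (VQ i (Suc k))"
  shows "\<not> nb (VP i k) (VP i (Suc k))"
proof
  assume P: "nb (VP i k) (VP i (Suc k))"
  let ?C = "{VP i k, VM i k, VQ i k, VQ i (Suc k), VM i (Suc k), VP i (Suc k)}"
  have r: "nb (VM i k) (VP i k)" "nb (VM i k) (VQ i k)"
      "nb (VM i (Suc k)) (VP i (Suc k))" "nb (VM i (Suc k)) (VQ i (Suc k))"
    using rung k by auto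
  have eqs: "nb (VP i k) u \<longleftrightarrow> u = VM i k \<or> u = VP i (Suc k)"
      "nb (VM i k) u \<longleftrightarrow> u = VP i k \<or> u = VQ i k"
      "nb (VQ i k) u \<longleftrightarrow> u = VM i k \<or> u = VQ i (Suc k)"
      "nb (VQ i (Suc k)) u \<longleftrightarrow> u = VM i (Suc k) \<or> u = VQ i k"
      "nb (VM i (Suc k)) u \<longleftrightarrow> u = VP i (Suc k) \<or> u = VQ i (Suc k)"
      "nb (VP i (Suc k)) u \<longleftrightarrow> u = VM i (Suc k) \<or> u = VP i k" for u
    by (rule nb_eq_pair'; use P Q r nb_sym in \<open>simp; fail\<close>)+
  have "?C = verts t l m r"
  proof (rule nb_closed)
    show "?C \<subseteq> verts t l m r"
      using i k by auto
    show "?C \<noteq> {}"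
      by simp
    fix v u assume "v \<in> ?C" "nb v u"
    then show "u \<in> ?C"
      by (elim insertE emptyE) (simp_all add: eqs, (elim disjE; simp)+)
  qed
  then have eqC: "verts t l m r = ?C" ..
  \<comment> \<open>A third column of the row, which exists because \<open>l\<close> is at least 2,
    shows that the 6-cycle is not the whole tour.\<close>
  define k' where "k' = (if k = 0 then 2 else 0 :: nat)"
  have k': "k' \<le> l" "k' \<noteq> k" "k' \<noteq> Suc k"
    using l D_pos by (auto simp: k'_def)
  have "VP i k' \<in> ?C"
    unfolding eqC[symmetric] using i k'(1) by simp
  then show False
    using k'(2,3) by simp
qed

lemma rail_P:
  assumes k: "Suc k < l" and free: "\<And>j. \<not> attach a g j i (Suc k)" and no: "\<not> nb (VP i k) (VP i (Suc k))"
  shows "nb (VP i (Suc k)) (VP i (Suc (Suc k)))"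
proof -
  let ?v = "VP i (Suc k)"
  have "nb ?v u \<longleftrightarrow> u = VM i (Suc k) \<or> u = VP i (Suc (Suc k))" for u
  proof (rule nb_eq_pair)
    show "?v \<in> verts t l m r"
      using i k by simp
    fix u assume u: "nb ?v u"
    then have "u \<noteq> VP i k"
      using no nb_sym by blast
    then show "u = VM i (Suc k) \<or> u = VP i (Suc (Suc k))"
      using nb_saturated[OF sat_row(1) u] vadj_VP[of l a g i "Suc k" u] k free by auto
  qed
  then show ?thesis
    by blast
qed

lemma rail_P':
  assumes k: "Suc k < l" and free: "\<And>j. \<not> attach a g j i (Suc k)"
    and no: "\<not> nb (VP i (Suc k)) (VP i (Suc (Suc k)))"
  shows "nb (VP i k) (VP i (Suc k))"
  using rail_P[OF k free] no by blast

lemma full_P: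
  assumes k: "k \<le> l" and nb: "nb (VP i k) (VP i k')"
  shows "\<not> nb (VP i k) (VC j)"
proof -
  have "nb (VP i k) (VC j) \<longleftrightarrow> VC j = VM i k \<or> VC j = VP i k'"
    using rung(1)[OF k] nb nb_sym by (intro nb_eq_pair') auto
  then show ?thesis
    by simp
qed

text \<open>If the sign disagrees with the direction of the row, the \<open>VQ\<close> rail is used
  on the far side of the buffer next to \<open>k\<close>, hence the \<open>VP\<close> rail is not.
  The buffer vertex must then take the \<open>VP\<close> edge towards \<open>k\<close>, so
  \<open>VP i k\<close> is saturated by rung and rail and has no room for a clause.\<close>

lemma clause_attached:
  assumes j: "j < m" and nb: "nb (VC j) (VP i k)" and att: "attach a g j i k"
  shows "\<exists>s<3. sel (g j) s = decode (fst (a (j, s)))"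
proof -
  obtain s z where s: "s < 3" "a (j, s) = (i, z)"
    and k: "if sel (g j) s then k = 6 * z + 2 \<or> k = 6 * z + 3 else k = 6 * z + 5 \<or> k = 6 * z + 6"
    using att by (auto simp: attach_def)
  have z: "z < D"
    using ptr[OF j s(1)] s(2) by simp
  have nb': "nb (VP i k) (VC j)"
    using nb nb_sym by blast
  have free: "\<not> attach a g j' i k'" if "k' mod 6 = 1 \<or> k' mod 6 = 4" for j' k'
    using attach_mod that by blast
  have noP: "\<not> nb (VP i k') (VP i (Suc k'))" if "k' < l" "decode i \<longleftrightarrow> odd k'" for k'
    using not_both_rails rail_Q_iff that by blast
  have "sel (g j) s = decode i"
  proof (rule ccontr)
    assume ne: "sel (g j) s \<noteq> decode i"
    show False
    proof (cases "sel (g j) s")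
      case True
      then have dec: "\<not> decode i"
        using ne by simp
      consider "k = 6 * z + 2" | "k = 6 * z + 3"
        using k True by auto
      then show False
      proof cases
        case 1
        have "nb (VP i (Suc (6 * z))) (VP i (Suc (Suc (6 * z))))"
          using z l dec noP[of "6 * z"] free[of "Suc (6 * z)"] by (intro rail_P) auto
        then show False
          using full_P[of k "Suc (6 * z)" j] nb' 1 z l nb_sym by (auto simp: eval_nat_numeral)
      next
        case 2
        have "nb (VP i (6 * z + 3)) (VP i (Suc (6 * z + 3)))"
          using z l dec noP[of "Suc (6 * z + 3)"] free[of "Suc (6 * z + 3)"]
          by (intro rail_P') (auto simp: mod_Suc)
        then show False
          using full_P[of k "Suc (6 * z + 3)" j] nb' 2 z l by auto
      qed
    next
      case False
      then have dec: "decode i"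
        using ne by simp
      consider "k = 6 * z + 5" | "k = 6 * z + 6"
        using k False by auto
      then show False
      proof cases
        case 1
        have "nb (VP i (Suc (6 * z + 3))) (VP i (Suc (Suc (6 * z + 3))))"
          using z l dec noP[of "6 * z + 3"] free[of "Suc (6 * z + 3)"]
          by (intro rail_P) (auto simp: mod_Suc)
        then have "nb (VP i k) (VP i (Suc (6 * z + 3)))"
          using 1 nb_sym by (simp add: eval_nat_numeral)
        then show False
          using full_P[of k "Suc (6 * z + 3)" j] nb' 1 z l by auto
      next
        case 2
        have "nb (VP i (6 * z + 6)) (VP i (Suc (6 * z + 6)))"
          using z l dec noP[of "Suc (6 * z + 6)"] free[of "Suc (6 * z + 6)"]
          by (intro rail_P') (auto simp: mod_Suc)
        then show False
          using full_P[of k "Suc (6 * z + 6)" j] nb' 2 z l by auto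
      qed
    qed
  qed
  then show ?thesis
    using s by auto
qed

end

text \<open>A violated clause is either unsaturated itself or has a tour neighbour in a row that is
  not clean, and then one of its pointers goes to that row. Every such row contains an unsaturated
  vertex of its own.\<close>

lemma card_unsat_clauses_le:
  defines "Bad \<equiv> {v \<in> verts t l m r. \<not> saturated v}"
  shows "\<exists>Dirty\<subseteq>{..<t}. card Dirty \<le> card Bad \<and>
    card {j. j < m \<and> (\<forall>s<3. sel (g j) s \<noteq> decode (fst (a (j, s))))}
      \<le> card Bad + card {e \<in> {..<m} \<times> {..<3}. fst (a e) \<in> Dirty}"
proof (intro exI conjI)
  define Dirty where "Dirty = {i. i < t \<and> \<not> clean i}"
  show "Dirty \<subseteq> {..<t}"
    by (auto simp: Dirty_def)
  have finB: "finite Bad"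
    using finite_verts by (simp add: Bad_def)
  have "Dirty \<subseteq> vrow ` Bad"
  proof
    fix i assume "i \<in> Dirty"
    then have i: "i < t" "\<not> clean i"
      by (simp_all add: Dirty_def)
    from i(2) obtain k where k: "k \<le> l" "\<not> (saturated (VP i k) \<and> saturated (VM i k) \<and> saturated (VQ i k))"
      unfolding clean_def by meson
    have "VP i k \<in> Bad \<or> VM i k \<in> Bad \<or> VQ i k \<in> Bad"
      using i(1) k by (auto simp: Bad_def)
    then show "i \<in> vrow ` Bad"
      by (elim disjE; simp add: rev_image_eqI)
  qed
  then show "card Dirty \<le> card Bad"
    by (rule surj_card_le[OF finB])
  let ?J = "{j. j < m \<and> (\<forall>s<3. sel (g j) s \<noteq> decode (fst (a (j, s))))}"
  let ?E = "{e \<in> {..<m} \<times> {..<3}. fst (a e) \<in> Dirty}"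
  have "?J \<subseteq> {j. VC j \<in> Bad} \<union> fst ` ?E"
  proof
    fix j assume j: "j \<in> ?J"
    show "j \<in> {j. VC j \<in> Bad} \<union> fst ` ?E"
    proof (cases "VC j \<in> Bad")
      case True
      then show ?thesis by simp
    next
      case False
      then have satj: "saturated (VC j)"
        using j by (simp add: Bad_def)
      obtain u where u: "nb (VC j) u"
        using ex_nb[of "VC j"] j by auto
      then obtain i k where ik: "u = VP i k" "attach a g j i k"
        using nb_saturated[OF satj] vadj_VC by blast
      obtain s where s: "s < 3" "fst (a (j, s)) = i"
        using ik(2) by (auto simp: attach_def)
      have i: "i < t"
        using ptr[of j s] s j by auto
      have "\<not> clean i"
        using clause_attached[OF i _ _ _ ik(2)] u ik(1) j by auto
      then have "(j, s) \<in> ?E"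
        using i s j by (auto simp: Dirty_def)
      then show ?thesis
        by force
    qed
  qed
  moreover have fin: "finite {j. VC j \<in> Bad}" "finite ?E"
    using finB by (auto intro: finite_vimageI[of Bad VC, unfolded vimage_def] simp: inj_on_def)
  ultimately have "card ?J \<le> card ({j. VC j \<in> Bad} \<union> fst ` ?E)"
    by (intro card_mono) auto
  also have "\<dots> \<le> card {j. VC j \<in> Bad} + card (fst ` ?E)"
    by (rule card_Un_le)
  also have "\<dots> \<le> card Bad + card ?E"
    using finB fin by (intro add_mono card_inj_on_le[of VC] card_image_le) (auto simp: inj_on_def)
  finally show "card ?J \<le> card Bad + card ?E" .
qed

end

section \<open>A tour from a satisfying assignment\<close>

lemma successively_concat_map:
  assumes "\<And>x. x \<in> set xs \<Longrightarrow> f x \<noteq> [] \<and> successively P (f x)"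
    and "successively (\<lambda>x y. P (last (f x)) (hd (f y))) xs"
  shows "successively P (concat (map f xs))"
  using assms
proof (induction xs)
  case (Cons x xs)
  show ?case
  proof (cases xs)
    case Nil
    then show ?thesis
      using Cons.prems by simp
  next
    case (Cons y ys)
    then have "hd (concat (map f xs)) = hd (f y)"
      using Cons.prems(1)[of y] by simp
    moreover have "successively P (concat (map f xs))"
      using Cons.prems Cons by (intro Cons.IH) auto
    ultimately show ?thesis
      using Cons.prems Cons by (simp add: successively_append_iff)
  qed
qed simp

lemma successively_upt:
  assumes "\<And>k. Suc k < n \<Longrightarrow> Q k (Suc k)"
  shows "successively Q [0..<n]"
  using assms by (simp add: successively_conv_nth)

lemma distinct_concat_map:
  assumes "distinct xs" "\<And>x. x \<in> set xs \<Longrightarrow> distinct (f x)"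
    and "\<And>x v. x \<in> set xs \<Longrightarrow> v \<in> set (f x) \<Longrightarrow> key v = x"
  shows "distinct (concat (map f xs))"
  using assms
proof (induction xs)
  case (Cons x xs)
  have "set (f x) \<inter> set (concat (map f xs)) = {}"
  proof (intro equals0I)
    fix v assume "v \<in> set (f x) \<inter> set (concat (map f xs))"
    then obtain y where y: "v \<in> set (f x)" "y \<in> set xs" "v \<in> set (f y)"
      by auto
    then have "key v = x" "key v = y"
      using Cons.prems(3) by simp_all
    then show False
      using y Cons.prems(1) by simp
  qed
  moreover have "distinct (concat (map f xs))"
    using Cons.prems by (intro Cons.IH) simp_all
  ultimately show ?case
    using Cons.prems(2) by simp
qed simp

locale snake =
  fixes t D m l :: nat and a :: pointers and g :: signs and x :: "nat \<Rightarrow> bool" and s :: "nat \<Rightarrow> nat"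
  assumes l: "l = 6 * D + 2"
    and ptr: "\<And>j s. j < m \<Longrightarrow> s < 3 \<Longrightarrow> fst (a (j, s)) < t \<and> snd (a (j, s)) < D"
    and s: "\<And>j. j < m \<Longrightarrow> s j < 3 \<and> sel (g j) (s j) = x (fst (a (j, s j)))"
begin

definition slot :: "nat \<Rightarrow> nat \<times> nat" where
  "slot j = a (j, s j)"

definition used :: "nat \<times> nat \<Rightarrow> bool" where
  "used y \<longleftrightarrow> (\<exists>j<m. slot j = y)"

text \<open>Clauses that chose the same slot compete for it; one gets it, and the others are
  appended to the tour as \<open>unplaced\<close>.\<close>

definition pick :: "nat \<times> nat \<Rightarrow> nat" where
  "pick y = (SOME j. j < m \<and> slot j = y)"

text \<open>At column 2 modulo 6 of a true row, or 5 of a false one, the block ends on the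
  \<open>VP\<close> rail and the next block starts there, so the clause replaces that rail
  edge.\<close>

definition ins :: "nat \<Rightarrow> nat \<Rightarrow> vtx list" where
  "ins i k = (if k mod 6 = (if x i then 2 else 5) \<and> used (i, k div 6) then [VC (pick (i, k div 6))] else [])"

definition blk :: "nat \<Rightarrow> nat \<Rightarrow> vtx list" where
  "blk i k = (if x i = even k then [VQ i k, VM i k, VP i k] else [VP i k, VM i k, VQ i k]) @ ins i k"

definition rowlist :: "nat \<Rightarrow> vtx list" where
  "rowlist i = concat (map (blk i) [0..<Suc l])"

definition ladder :: "vtx list" where
  "ladder = concat (map rowlist [0..<t])"

definition unplaced :: "nat set" where
  "unplaced = {j. j < m \<and> pick (slot j) \<noteq> j}"

lemma pick: "used y \<Longrightarrow> pick y < m \<and> slot (pick y) = y"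
  unfolding used_def pick_def by (rule someI_ex)

lemma slot_bounds: "j < m \<Longrightarrow> fst (slot j) < t \<and> snd (slot j) < D"
  using ptr s by (simp add: slot_def)

lemma attach_slot:
  assumes "j < m" "slot j = (i, k div 6)" "k mod 6 = (if x i then 2 else 5)"
  shows "attach a g j i k" "attach a g j i (Suc k)"
proof -
  have k: "k = 6 * (k div 6) + (if x i then 2 else 5)"
    using assms(3) by (metis mult_div_mod_eq)
  have "sel (g j) (s j) = x i" "s j < 3" "a (j, s j) = (i, k div 6)"
    using s[OF assms(1)] assms(2) by (auto simp: slot_def)
  then show "attach a g j i k" "attach a g j i (Suc k)"
    unfolding attach_def using k
    by (intro exI[of _ "s j"] conjI exI[of _ "k div 6"]; simp split: if_splits)+
qed

lemma ins_cases:
  obtains "ins i k = []"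
  | j where "ins i k = [VC j]" "j < m" "slot j = (i, k div 6)" "k mod 6 = (if x i then 2 else 5)"
    "x i = even k" "pick (slot j) = j"
proof (cases "k mod 6 = (if x i then 2 else 5) \<and> used (i, k div 6)")
  case True
  have "even k \<longleftrightarrow> even (k mod 6)"
    by presburger
  then have "x i = even k"
    using True by auto
  then show ?thesis
    using True pick[of "(i, k div 6)"] that(2)[of "pick (i, k div 6)"] by (simp add: ins_def)
next
  case False
  then show ?thesis
    using that(1) by (simp add: ins_def)
qed

text \<open>Column \<open>l\<close> = 6 D + 2 has the residue of an insertion point in true rows,
  but its slot would have number \<open>D\<close>, to which no pointer leads.\<close>

lemma ins_last: "ins i l = []"
proof (cases rule: ins_cases[of i l])
  case (2 j)
  have "l div 6 = D"
    by (simp add: l)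
  then show ?thesis
    using slot_bounds[of j] 2 by simp
qed

lemma blk_ne: "blk i k \<noteq> []"
  by (simp add: blk_def)

lemma hd_blk: "hd (blk i k) = (if x i = even k then VQ i k else VP i k)"
  by (simp add: blk_def)

lemma successively_blk: "successively (vadj l a g) (blk i k)"
proof (cases rule: ins_cases[of i k])
  case 1
  then show ?thesis
    by (simp add: blk_def vadj_def)
next
  case (2 j)
  then show ?thesis
    using attach_slot(1)[of j i k] by (simp add: blk_def vadj_def)
qed

lemma blk_link: "vadj l a g (last (blk i k)) (hd (blk i (Suc k)))"
proof (cases rule: ins_cases[of i k])
  case 1
  then show ?thesis
    by (simp add: hd_blk) (simp add: blk_def vadj_def)
next
  case (2 j)
  then show ?thesis
    using attach_slot(2)[of j i k] by (simp add: hd_blk) (simp add: blk_def vadj_def)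
qed

lemma rowlist_ne: "rowlist i \<noteq> []"
  using blk_ne by (simp add: rowlist_def)

lemma hd_rowlist: "hd (rowlist i) = (if x i then VQ i 0 else VP i 0)"
proof -
  have "rowlist i = blk i 0 @ concat (map (blk i) [1..<Suc l])"
    unfolding rowlist_def by (subst upt_conv_Cons) auto
  then show ?thesis
    using blk_ne by (simp add: hd_blk)
qed

lemma last_rowlist: "last (rowlist i) = VP i l \<or> last (rowlist i) = VQ i l"
proof -
  have "rowlist i = concat (map (blk i) [0..<l]) @ blk i l"
    by (simp add: rowlist_def)
  then show ?thesis
    using blk_ne by (auto simp: blk_def ins_last)
qed

lemma successively_rowlist: "successively (vadj l a g) (rowlist i)"
  unfolding rowlist_def
  by (intro successively_concat_map successively_upt) (simp_all add: blk_ne successively_blk blk_link)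

lemma successively_ladder: "successively (vadj l a g) ladder"
  unfolding ladder_def
proof (intro successively_concat_map successively_upt conjI)
  fix i
  show "vadj l a g (last (rowlist i)) (hd (rowlist (Suc i)))"
    using last_rowlist[of i] by (auto simp: hd_rowlist vadj_def)
qed (simp_all add: rowlist_ne successively_rowlist)

text \<open>Row and column at which a vertex is visited; these labels separate the blocks and so
  give distinctness.\<close>

fun rkey :: "vtx \<Rightarrow> nat" where
  "rkey (VC j) = fst (slot j)"
| "rkey v = vrow v"

fun ckey :: "vtx \<Rightarrow> nat" where
  "ckey (VP i k) = k"
| "ckey (VM i k) = k"
| "ckey (VQ i k) = k"
| "ckey (VC j) = 6 * snd (slot j) + (if x (fst (slot j)) then 2 else 5)"
| "ckey (VU r) = undefined"

lemma set_blk: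
  assumes "v \<in> set (blk i k)"
  shows "v \<in> {VP i k, VM i k, VQ i k} \<or> (\<exists>j<m. v = VC j \<and> slot j = (i, k div 6)
    \<and> k mod 6 = (if x i then 2 else 5) \<and> pick (slot j) = j)"
proof (cases rule: ins_cases[of i k])
  case 1
  then show ?thesis
    using assms by (auto simp: blk_def split: if_splits)
next
  case (2 j)
  then show ?thesis
    using assms by (auto simp: blk_def split: if_splits)
qed

lemma keys_blk:
  assumes "v \<in> set (blk i k)"
  shows "rkey v = i \<and> ckey v = k"
  using set_blk[OF assms]
proof (elim disjE exE conjE)
  fix j assume j: "v = VC j" "slot j = (i, k div 6)" "k mod 6 = (if x i then 2 else 5)"
  have "6 * (k div 6) + k mod 6 = k"
    by simp
  then show ?thesis
    using j by simp
qed auto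

lemma distinct_blk: "distinct (blk i k)"
  by (cases rule: ins_cases[of i k]) (auto simp: blk_def)

lemma distinct_ladder: "distinct ladder"
  unfolding ladder_def
proof (rule distinct_concat_map[where key = rkey])
  fix i
  show "distinct (rowlist i)"
    unfolding rowlist_def using distinct_blk keys_blk
    by (intro distinct_concat_map[where key = ckey]) auto
  show "rkey v = i" if "v \<in> set (rowlist i)" for v
    using that keys_blk by (auto simp: rowlist_def)
qed simp

lemma set_ladder:
  "set ladder = {VP i k | i k. i < t \<and> k \<le> l} \<union> {VM i k | i k. i < t \<and> k \<le> l}
     \<union> {VQ i k | i k. i < t \<and> k \<le> l} \<union> VC ` ({..<m} - unplaced)" (is "_ = ?R")
proof (intro equalityI subsetI)
  fix v assume "v \<in> set ladder"
  then obtain i k where ik: "i < t" "k \<le> l" "v \<in> set (blk i k)"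
    unfolding ladder_def rowlist_def by (auto simp: atLeast0LessThan less_Suc_eq_le simp del: upt_Suc)
  show "v \<in> ?R"
    using set_blk[OF ik(3)] ik(1,2) by (auto simp: unplaced_def)
next
  fix v assume v: "v \<in> ?R"
  have mem: "v \<in> set ladder" if "i < t" "k \<le> l" "v \<in> set (blk i k)" for i k
  proof -
    have "v \<in> set (rowlist i)"
      using that unfolding rowlist_def by (auto simp: less_Suc_eq_le simp del: upt_Suc intro!: bexI[of _ k])
    then show ?thesis
      using that unfolding ladder_def by (auto intro!: bexI[of _ i])
  qed
  have base: "{VP i k, VM i k, VQ i k} \<subseteq> set (blk i k)" for i k
    by (auto simp: blk_def)
  show "v \<in> set ladder"
  proof (cases "\<exists>i k. i < t \<and> k \<le> l \<and> v \<in> {VP i k, VM i k, VQ i k}")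
    case True
    then show ?thesis
      using mem base by blast
  next
    case False
    then obtain j where j: "v = VC j" "j < m" "pick (slot j) = j"
      using v by (auto simp: unplaced_def)
    define i k where "i = fst (slot j)" and "k = 6 * snd (slot j) + (if x (fst (slot j)) then 2 else 5)"
    have k: "k div 6 = snd (slot j)" "k mod 6 = (if x i then 2 else 5)"
      by (auto simp: k_def i_def)
    have "used (slot j)"
      using j by (auto simp: used_def)
    then have "v \<in> set (blk i k)"
      using j k by (simp add: blk_def ins_def i_def)
    moreover have "i < t" "k \<le> l"
      using slot_bounds[OF j(2)] by (auto simp: i_def k_def l)
    ultimately show ?thesis
      using mem by blast
  qed
qed

text \<open>An unplaced clause shares its slot with the clause placed there, which gives a colliding
  pair of pointers.\<close>

lemma card_unplaced_le:
  "card unplaced \<le> card {(e, e'). e \<in> {..<m} \<times> {..<3::nat} \<and> e' \<in> {..<m} \<times> {..<3::nat} \<and> e \<noteq> e' \<and> a e = a e'}"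
proof (rule card_inj_on_le[where f = "\<lambda>j. ((j, s j), (pick (slot j), s (pick (slot j))))"])
  show "inj_on (\<lambda>j. ((j, s j), (pick (slot j), s (pick (slot j))))) unplaced"
    by (auto simp: inj_on_def)
  show "(\<lambda>j. ((j, s j), (pick (slot j), s (pick (slot j))))) ` unplaced
      \<subseteq> {(e, e'). e \<in> {..<m} \<times> {..<3::nat} \<and> e' \<in> {..<m} \<times> {..<3::nat} \<and> e \<noteq> e' \<and> a e = a e'}"
  proof
    fix p assume "p \<in> (\<lambda>j. ((j, s j), (pick (slot j), s (pick (slot j))))) ` unplaced"
    then obtain j where j: "j < m" "pick (slot j) \<noteq> j" "p = ((j, s j), (pick (slot j), s (pick (slot j))))"
      by (auto simp: unplaced_def)
    have "used (slot j)"
      using j by (auto simp: used_def)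
    from pick[OF this] have "pick (slot j) < m" "a (pick (slot j), s (pick (slot j))) = a (j, s j)"
      by (auto simp: slot_def)
    then show "p \<in> {(e, e'). e \<in> {..<m} \<times> {..<3::nat} \<and> e' \<in> {..<m} \<times> {..<3::nat} \<and> e \<noteq> e' \<and> a e = a e'}"
      using j s by auto
  qed
  have "finite (({..<m} \<times> {..<3::nat}) \<times> ({..<m} \<times> {..<3::nat}))"
    by auto
  then show "finite {(e, e'). e \<in> {..<m} \<times> {..<3::nat} \<and> e' \<in> {..<m} \<times> {..<3::nat} \<and> e \<noteq> e' \<and> a e = a e'}"
    by (rule rev_finite_subset) auto
qed

lemma ex_tour:
  "\<exists>ys zs. distinct (ys @ zs) \<and> set (ys @ zs) = verts t l m r \<and> successively (vadj l a g) ys \<and>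
    length zs \<le> card {(e, e'). e \<in> {..<m} \<times> {..<3::nat} \<and> e' \<in> {..<m} \<times> {..<3::nat} \<and> e \<noteq> e' \<and> a e = a e'} + r"
proof -
  have fin: "finite unplaced"
    by (simp add: unplaced_def)
  then obtain us where us: "distinct us" "set us = unplaced"
    using finite_distinct_list by blast
  define zs where "zs = map VC us @ map VU [0..<r]"
  have "distinct zs"
    using us by (auto simp: zs_def distinct_map inj_on_def)
  moreover have "set zs = VC ` unplaced \<union> VU ` {..<r}"
    using us by (auto simp: zs_def)
  moreover have "unplaced \<subseteq> {..<m}"
    by (auto simp: unplaced_def)
  ultimately have "distinct (ladder @ zs)" "set (ladder @ zs) = verts t l m r"
    using distinct_ladder set_ladder by (auto simp: verts_def)
  moreover have "length zs = card unplaced + r"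
    using us distinct_card[of us] by (simp add: zs_def)
  ultimately show ?thesis
    using successively_ladder card_unplaced_le by (intro exI[of _ ladder] exI[of _ zs]) auto
qed

end

section \<open>Random clauses\<close>

text \<open>A degree is at most \<open>\<tau>\<close> or at most its square divided by
  \<open>\<tau>\<close>, and the sum of the squares counts pairs with equal image, diagonal
  included. Few rows therefore cannot hold many pointers, although single rows may be heavy.\<close>

lemma card_image_in_le:
  fixes f :: "'e \<Rightarrow> nat" and \<tau> :: real
  assumes E: "finite E" and U: "U \<subseteq> {..<t}" and \<tau>: "\<tau> > 0"
  shows "real (card {e \<in> E. f e \<in> U})
    \<le> \<tau> * card U + (card E + card {(e, e'). e \<in> E \<and> e' \<in> E \<and> e \<noteq> e' \<and> f e = f e'}) / \<tau>"
proof -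
  define deg where "deg i = real (card {e \<in> E. f e = i})" for i
  have finU: "finite U"
    using U finite_subset by blast
  have "{e \<in> E. f e \<in> U} = (\<Union>i\<in>U. {e \<in> E. f e = i})"
    by auto
  then have "card {e \<in> E. f e \<in> U} = (\<Sum>i\<in>U. card {e \<in> E. f e = i})"
    using E finU by (subst card_UN_disjoint[symmetric]) auto
  then have "real (card {e \<in> E. f e \<in> U}) = (\<Sum>i\<in>U. deg i)"
    by (simp add: deg_def)
  also have "\<dots> \<le> (\<Sum>i\<in>U. \<tau> + (deg i)\<^sup>2 / \<tau>)"
  proof (intro sum_mono)
    fix i
    show "deg i \<le> \<tau> + (deg i)\<^sup>2 / \<tau>"
    proof (cases "deg i \<le> \<tau>")
      case True
      then show ?thesis
        using \<tau> by (smt (verit) divide_nonneg_pos zero_le_power2)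
    next
      case False
      then have "deg i * \<tau> \<le> deg i * deg i"
        by (intro mult_left_mono) (auto simp: deg_def)
      then have "deg i \<le> (deg i)\<^sup>2 / \<tau>"
        using \<tau> by (simp add: field_simps power2_eq_square)
      then show ?thesis
        using \<tau> by simp
    qed
  qed
  also have "\<dots> = \<tau> * card U + (\<Sum>i\<in>U. (deg i)\<^sup>2) / \<tau>"
    by (simp add: sum.distrib sum_divide_distrib)
  also have "(\<Sum>i\<in>U. (deg i)\<^sup>2) \<le> card E + card {(e, e'). e \<in> E \<and> e' \<in> E \<and> e \<noteq> e' \<and> f e = f e'}"
  proof -
    let ?S = "\<lambda>i. {e \<in> E. f e = i} \<times> {e \<in> E. f e = i}"
    let ?X = "{(e, e'). e \<in> E \<and> e' \<in> E \<and> e \<noteq> e' \<and> f e = f e'}"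
    have fin: "finite ?X" "finite ((\<lambda>e. (e, e)) ` E)"
      using E by (auto intro: rev_finite_subset[of "E \<times> E"])
    have "(\<Sum>i\<in>U. (deg i)\<^sup>2) = (\<Sum>i\<in>U. real (card (?S i)))"
      by (simp add: deg_def card_cartesian_product power2_eq_square)
    also have "\<dots> = real (card (\<Union>i\<in>U. ?S i))"
      using E finU by (subst card_UN_disjoint) auto
    also have "\<dots> \<le> real (card ((\<lambda>e. (e, e)) ` E \<union> ?X))"
      using fin by (intro of_nat_mono card_mono) auto
    also have "\<dots> \<le> real (card ((\<lambda>e. (e, e)) ` E) + card ?X)"
      by (intro of_nat_mono card_Un_le)
    also have "card ((\<lambda>e. (e, e)) ` E) = card E"
      by (intro card_image) (auto simp: inj_on_def)
    finally show ?thesis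
      by simp
  qed
  finally show ?thesis
    using \<tau> by (simp add: divide_right_mono)
qed

text \<open>The averaging half of Yao's principle. The weights may be negative, so a difference of
  expectations under two distributions of instances can be bounded tree by tree.\<close>

lemma pmf_average_le:
  fixes c :: "'i \<Rightarrow> real"
  assumes "finite I" "\<And>T. T \<in> set_pmf A \<Longrightarrow> (\<Sum>i\<in>I. c i * of_bool (P i T)) \<le> \<delta>"
  shows "(\<Sum>i\<in>I. c i * measure_pmf.prob A {T. P i T}) \<le> \<delta>"
proof -
  have int: "integrable (measure_pmf A) (\<lambda>T. c i * indicator {T. P i T} T)" for i
    by (intro integrable_mult_right measure_pmf.integrable_const_bound[where B = 1]) auto
  have "(\<Sum>i\<in>I. c i * measure_pmf.prob A {T. P i T})
      = (\<Sum>i\<in>I. measure_pmf.expectation A (\<lambda>T. c i * indicator {T. P i T} T))"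
    by simp
  also have "\<dots> = measure_pmf.expectation A (\<lambda>T. \<Sum>i\<in>I. c i * indicator {T. P i T} T)"
    by (rule Bochner_Integration.integral_sum[symmetric]) (rule int)
  also have "\<dots> \<le> measure_pmf.expectation A (\<lambda>_. \<delta>)"
  proof (rule integral_mono_AE)
    show "integrable (measure_pmf A) (\<lambda>T. \<Sum>i\<in>I. c i * indicator {T. P i T} T)"
      by (intro Bochner_Integration.integrable_sum int)
    show "AE T in measure_pmf A. (\<Sum>i\<in>I. c i * indicator {T. P i T} T) \<le> \<delta>"
      using assms(2) by (auto simp: AE_measure_pmf_iff indicator_def of_bool_def)
  qed auto
  finally show ?thesis
    by simp
qed

lemma less_3_cases: "s < 3 \<longleftrightarrow> s = 0 \<or> s = 1 \<or> s = (2::nat)"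
  by auto

context hidden_pointers
begin

definition unsat :: "pointers \<Rightarrow> (nat \<Rightarrow> bool) \<Rightarrow> signs \<Rightarrow> nat set" where
  "unsat a x g = {j. j < m \<and> (\<forall>s<3. sel (g j) s \<noteq> x (fst (a (j, s))))}"

text \<open>Without a true literal all three signs disagree with \<open>x\<close>, so
  \<open>chi\<close> is -1 and the density vanishes.\<close>

lemma planted_satisfied:
  assumes "planted a x g \<noteq> 0" "j < m"
  shows "\<exists>s<3. sel (g j) s = x (fst (a (j, s)))"
proof (rule ccontr)
  assume "\<not> (\<exists>s<3. sel (g j) s = x (fst (a (j, s))))"
  then have "sg (sel (g j) s) * sg (x (fst (a (j, s)))) = -1" if "s < 3" for s
    using that by (auto simp: sg_def)
  then have "(\<Prod>s<3. sg (sel (g j) s) * sg (x (fst (a (j, s))))) = (\<Prod>s<3::nat. -1)"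
    by (intro prod.cong) auto
  then have "chi a x g j + 1 = 0"
    by (simp add: chi_def prod.distrib)
  then show False
    using assms by (auto simp: planted_def)
qed

text \<open>For fixed \<open>x\<close>, exactly one of the eight sign triples violates a given
  clause, so each clause contributes 7 + 1/16 = 113/16.\<close>

lemma sum_unsat_generating:
  "(\<Sum>g\<in>sgns. (1 / 16) ^ card (unsat a x g)) = (113 / 16 :: real) ^ m"
proof -
  define c where "c j = (\<not> x (fst (a (j, 0))), \<not> x (fst (a (j, 1))), \<not> x (fst (a (j, 2))))" for j
  have iff: "(\<forall>s<3. sel b s \<noteq> x (fst (a (j, s)))) \<longleftrightarrow> b = c j" for b j
    by (cases b) (auto simp: c_def less_3_cases all_conj_distrib imp_conjL)
  have total: "(\<Sum>b\<in>UNIV. if b = c j then 1 / 16 else 1 :: real) = 113 / 16" for j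
  proof -
    have "(\<Sum>b\<in>UNIV. if b = c j then 1 / 16 else 1 :: real) = 1 / 16 + (\<Sum>b\<in>UNIV - {c j}. 1)"
      by (subst sum.remove[of _ "c j"]) auto
    also have "(\<Sum>b\<in>UNIV - {c j}. 1 :: real) = 7"
    proof -
      have "CARD(bool \<times> bool \<times> bool) = 8"
        by (simp add: card_UNIV_bool flip: UNIV_Times_UNIV)
      then show ?thesis
        by (simp add: card_Diff_singleton)
    qed
    finally show ?thesis
      by simp
  qed
  have "(\<Sum>g\<in>sgns. (1 / 16 :: real) ^ card (unsat a x g)) = (\<Sum>g\<in>sgns. \<Prod>j<m. if g j = c j then 1 / 16 else 1)"
  proof (intro sum.cong refl)
    fix g :: signs
    have "unsat a x g = {..<m} \<inter> {j. g j = c j}"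
      unfolding unsat_def iff by auto
    then show "(1 / 16 :: real) ^ card (unsat a x g) = (\<Prod>j<m. if g j = c j then 1 / 16 else 1)"
      by (simp add: prod.If_cases)
  qed
  also have "\<dots> = (\<Prod>j<m. \<Sum>b\<in>UNIV. if b = c j then 1 / 16 else 1)"
    unfolding sgns_def by (subst prod_sum_PiE) auto
  also have "\<dots> = (\<Prod>j<m. 113 / 16)"
    by (simp only: total)
  finally show ?thesis
    by simp
qed

text \<open>An exponential-moment bound with base 1/16, then a union bound over \<open>2 ^ t\<close>
  assignments. The 64 clauses per variable make 32 * (113/128)^64, about 0.011, small
  enough.\<close>

lemma freq_few_unsat_le:
  assumes m: "m = 64 * t"
  shows "freq sgns (\<lambda>g. \<exists>x\<in>asgs. card (unsat a x g) < t) \<le> 1 / 20"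
proof -
  have one: "freq sgns (\<lambda>g. card (unsat a x g) < t) \<le> (16 * (113 / 128) ^ 64) ^ t" for x
  proof -
    have "freq sgns (\<lambda>g. card (unsat a x g) < t) \<le> freq sgns (\<lambda>g. (1 / 16 :: real) ^ card (unsat a x g) \<ge> (1 / 16) ^ t)"
      by (intro freq_mono finite_sgns power_decreasing) auto
    also have "\<dots> \<le> (\<Sum>g\<in>sgns. (1 / 16) ^ card (unsat a x g)) / ((1 / 16) ^ t * card sgns)"
      by (intro freq_markov finite_sgns) auto
    also have "\<dots> = (113 / 16) ^ m / 8 ^ m / (1 / 16) ^ t"
      by (simp only: sum_unsat_generating card_sgns of_nat_power of_nat_numeral divide_divide_eq_left mult.commute)
    also have "(113 / 16 :: real) ^ m / 8 ^ m = (113 / 128) ^ m"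
      by (simp flip: power_divide)
    also have "(113 / 128 :: real) ^ m / (1 / 16) ^ t = (16 * (113 / 128) ^ 64) ^ t"
    proof -
      have "B ^ t / (1 / 16) ^ t = (16 * B) ^ t" for B :: real
        by (simp add: power_mult_distrib power_divide)
      then show ?thesis
        unfolding m power_mult .
    qed
    finally show ?thesis .
  qed
  have "freq sgns (\<lambda>g. \<exists>x\<in>asgs. card (unsat a x g) < t) \<le> (\<Sum>x\<in>asgs. freq sgns (\<lambda>g. card (unsat a x g) < t))"
    by (intro freq_Ex_le finite_sgns finite_asgs)
  also have "\<dots> \<le> (\<Sum>x\<in>asgs. (16 * (113 / 128) ^ 64) ^ t)"
    by (intro sum_mono one)
  also have "\<dots> = (32 * (113 / 128) ^ 64) ^ t"
  proof -
    have "2 ^ t * (16 * B) ^ t = (2 * (16 * B)) ^ t" for B :: real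
      by (rule power_mult_distrib[symmetric])
    then have "2 ^ t * (16 * B) ^ t = (32 * B) ^ t" for B :: real
      by simp
    then show ?thesis
      unfolding sum_constant card_asgs of_nat_power of_nat_numeral .
  qed
  also have "\<dots> \<le> (1 / 20) ^ t"
    by (intro power_mono) (simp_all add: power_divide)
  also have "\<dots> \<le> (1 / 20) ^ 1"
    using t_pos by (intro power_decreasing) auto
  finally show ?thesis
    by simp
qed

definition collisions :: "pointers \<Rightarrow> nat" where
  "collisions a = card {(e, e'). e \<in> idx \<and> e' \<in> idx \<and> e \<noteq> e' \<and> a e = a e'}"

definition row_collisions :: "pointers \<Rightarrow> nat" where
  "row_collisions a = card {(e, e'). e \<in> idx \<and> e' \<in> idx \<and> e \<noteq> e' \<and> fst (a e) = fst (a e')}"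

lemma freq_collisions_le:
  assumes "b > 0"
  shows "freq ptrs (\<lambda>a. real (collisions a) \<ge> b) \<le> 9 * real m ^ 2 / (b * (t * D))"
proof -
  have "freq ptrs (\<lambda>a. real (collisions a) \<ge> b) \<le> real (card idx) ^ 2 * real 1 / (b * real (card slots))"
    unfolding ptrs_def collisions_def
  proof (rule freq_coinciding_pairs[OF finite_idx finite_slots slots_ne _ assms, of "(=)"])
    fix z assume "z \<in> slots"
    then have "{z' \<in> slots. z = z'} = {z}"
      by auto
    then show "card {z' \<in> slots. z = z'} = 1"
      by simp
  qed
  then show ?thesis
    by (simp add: card_idx card_slots power_mult_distrib)
qed

lemma freq_row_collisions_le:
  assumes "b > 0"
  shows "freq ptrs (\<lambda>a. real (row_collisions a) \<ge> b) \<le> 9 * real m ^ 2 / (b * t)"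
proof -
  have "freq ptrs (\<lambda>a. real (row_collisions a) \<ge> b) \<le> real (card idx) ^ 2 * real D / (b * real (card slots))"
    unfolding ptrs_def row_collisions_def
  proof (rule freq_coinciding_pairs[OF finite_idx finite_slots slots_ne _ assms, of "\<lambda>y z. fst y = fst z"])
    fix z assume "z \<in> slots"
    then have "{z' \<in> slots. fst z = fst z'} = {fst z} \<times> {..<D}"
      by (auto simp: slots_def)
    then show "card {z' \<in> slots. fst z = fst z'} = D"
      by simp
  qed
  then show ?thesis
    using D_pos by (simp add: card_idx card_slots power_mult_distrib)
qed

end

section \<open>Hard instances\<close>

text \<open>Only distances between a clause and a \<open>VP\<close> vertex depend on the hidden
  data. Columns 6 z + 2 to 6 z + 7 are assigned to slot z, hence the shift by 2; columns 0 and 1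
  fall to slot 0 by truncation, and no clause attaches there.\<close>

definition probe_of :: "nat \<Rightarrow> (nat \<Rightarrow> vtx) \<Rightarrow> nat \<Rightarrow> nat \<Rightarrow> (nat \<times> nat \<times> nat) option" where
  "probe_of n dec u w = (if u < n \<and> w < n then
     (case (dec u, dec w) of
        (VC j, VP i k) \<Rightarrow> Some (j, i, (k - 2) div 6)
      | (VP i k, VC j) \<Rightarrow> Some (j, i, (k - 2) div 6)
      | _ \<Rightarrow> None) else None)"

lemma attach_cong:
  assumes "\<And>s. s < 3 \<Longrightarrow> a (j, s) = (i, (k - 2) div 6) \<or> a' (j, s) = (i, (k - 2) div 6) \<Longrightarrow>
    a (j, s) = a' (j, s) \<and> g j = g' j"
  shows "attach a g j i k \<longleftrightarrow> attach a' g' j i k"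
proof -
  have imp: "attach b' h' j i k" if att: "attach b h j i k"
    and eq: "\<And>s. s < 3 \<Longrightarrow> b (j, s) = (i, (k - 2) div 6) \<Longrightarrow> b (j, s) = b' (j, s) \<and> h j = h' j"
    for b b' :: pointers and h h' :: signs
  proof -
    obtain s z where s: "s < 3" "b (j, s) = (i, z)"
      and k: "if sel (h j) s then k = 6 * z + 2 \<or> k = 6 * z + 3 else k = 6 * z + 5 \<or> k = 6 * z + 6"
      using att by (auto simp: attach_def)
    have "(k - 2) div 6 = z"
      using k by (auto split: if_splits)
    then have "b (j, s) = b' (j, s)" "h j = h' j"
      using eq[OF s(1)] s(2) by auto
    then show ?thesis
      using s k unfolding attach_def by (intro exI[of _ s] conjI exI[of _ z]) auto
  qed
  show ?thesis
  proof
    assume "attach a g j i k"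
    then show "attach a' g' j i k"
    proof (rule imp)
      fix s :: nat
      assume "s < 3" "a (j, s) = (i, (k - 2) div 6)"
      then show "a (j, s) = a' (j, s) \<and> g j = g' j"
        by (intro assms disjI1)
    qed
  next
    assume "attach a' g' j i k"
    then show "attach a g j i k"
    proof (rule imp)
      fix s :: nat
      assume "s < 3" "a' (j, s) = (i, (k - 2) div 6)"
      then show "a' (j, s) = a (j, s) \<and> g' j = g j"
        using assms[of s] by metis
    qed
  qed
qed

lemma vadj_cong:
  assumes "\<And>j i k. u = VC j \<and> w = VP i k \<or> u = VP i k \<and> w = VC j \<Longrightarrow> attach a g j i k = attach a' g' j i k"
  shows "vadj l a g u w = vadj l a' g' u w"
  using assms by (cases u; cases w) (auto simp: vadj_def)

locale hard_instances =
  fixes t D r :: nat and dec :: "nat \<Rightarrow> vtx" and l m n :: nat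
  assumes t0: "t > 0" and D0: "D > 0" and r0: "r > 0"
    and l: "l = 6 * D + 2" and m: "m = 64 * t" and n: "n = 3 * (t * Suc l) + m + r"
    and dec: "bij_betw dec {..<n} (verts t l m r)"
begin

definition inst :: "pointers \<Rightarrow> signs \<Rightarrow> nat \<Rightarrow> nat \<Rightarrow> nat" where
  "inst a g = adj_matrix n (\<lambda>u v. vadj l a g (dec u) (dec v))"

sublocale hidden_pointers t D m inst "probe_of n dec"
proof
  show "t > 0" "D > 0"
    by (fact t0 D0)+
  fix u w j z
  assume p: "probe_of n dec u w = Some (j, z)"
  then have uw: "u < n" "w < n"
    by (auto simp: probe_of_def split: if_splits)
  then have "dec u \<in> verts t l m r" "dec w \<in> verts t l m r"
    using dec by (auto simp: bij_betw_def)
  then show "fst z < t"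
    using p uw by (auto simp: probe_of_def split: vtx.splits)
next
  fix u w and a a' :: pointers and g g' :: signs
  assume *: "\<And>j z s. probe_of n dec u w = Some (j, z) \<Longrightarrow> s < 3 \<Longrightarrow> a (j, s) = z \<or> a' (j, s) = z \<Longrightarrow>
    a (j, s) = a' (j, s) \<and> g j = g' j"
  show "inst a g u w = inst a' g' u w"
  proof (cases "u < n \<and> w < n")
    case True
    have "vadj l a g (dec u) (dec w) = vadj l a' g' (dec u) (dec w)"
    proof (rule vadj_cong)
      fix j i k
      assume "dec u = VC j \<and> dec w = VP i k \<or> dec u = VP i k \<and> dec w = VC j"
      then have "probe_of n dec u w = Some (j, i, (k - 2) div 6)"
        using True by (auto simp: probe_of_def)
      then show "attach a g j i k = attach a' g' j i k"
        using * by (intro attach_cong) blast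
    qed
    then show ?thesis
      by (simp add: inst_def adj_matrix_def)
  next
    case False
    then show ?thesis
      by (auto simp: inst_def adj_matrix_def)
  qed
qed

lemma n_ge: "n > 64"
  using n m t0 by (simp add: less_Suc_eq_le)

lemma ptr_bounds: "a \<in> ptrs \<Longrightarrow> j < m \<Longrightarrow> s < 3 \<Longrightarrow> fst (a (j, s)) < t \<and> snd (a (j, s)) < D"
  using PiE_mem[of a idx "\<lambda>_. slots" "(j, s)"] by (auto simp: ptrs_def slots_def idx_def mem_Times_iff)

lemma ex_apex: "\<exists>w<n. dec w = VU 0"
proof -
  have "VU 0 \<in> dec ` {..<n}"
    using dec r0 by (simp add: bij_betw_def)
  then show ?thesis
    by auto
qed

lemma inst_onetwo: "inst a g \<in> onetwo_instances n"
  unfolding inst_def by (rule adj_matrix_onetwo) (rule vadj_sym)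

lemma inst_graphic: "inst a g \<in> graphic_instances n"
proof -
  obtain w where "w < n" "dec w = VU 0"
    using ex_apex by blast
  then show ?thesis
    unfolding inst_def by (intro adj_matrix_graphic[of _ w] vadj_sym) (simp_all add: vadj_apex)
qed

lemma tsp_cost_planted_le:
  assumes a: "a \<in> ptrs" and pl: "planted a x g \<noteq> 0"
  shows "tsp_cost n (inst a g) \<le> n + collisions a + r + 1"
proof -
  have "\<forall>j\<in>{..<m}. \<exists>s. s < 3 \<and> sel (g j) s = x (fst (a (j, s)))"
    using planted_satisfied[OF pl] by auto
  from bchoice[OF this] obtain s
    where s: "\<And>j. j < m \<Longrightarrow> s j < 3 \<and> sel (g j) (s j) = x (fst (a (j, s j)))"
    by auto
  have sn: "snake t D m l a g x s"
    by (rule snake.intro) (fact l, rule ptr_bounds[OF a], assumption+, rule s, assumption)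
  interpret snake t D m l a g x s
    by (rule sn)
  obtain ys zs where yz: "distinct (ys @ zs)" "set (ys @ zs) = verts t l m r" "successively (vadj l a g) ys"
    and len: "length zs \<le> collisions a + r"
    using ex_tour[of r] unfolding collisions_def idx_def by blast
  have "tsp_cost n (inst a g) \<le> n + length zs + 1"
    unfolding inst_def using n_ge by (intro tsp_cost_le_of_list[OF dec _ yz]) simp
  then show ?thesis
    using len by simp
qed

text \<open>The assignment decoded from an optimal tour violates at least \<open>t\<close> clauses,
  each charged to an unsaturated vertex or to a pointer into a dirty row. Since the row degrees have
  a bounded second moment, order \<open>t\<close> vertices are unsaturated, and these are charged to
  bad steps and apex vertices.\<close>

lemma tsp_cost_ge:
  assumes a: "a \<in> ptrs" and g: "\<forall>x\<in>asgs. card (unsat a x g) \<ge> t"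
    and coll: "real (row_collisions a) < 737280 * t"
  shows "real (tsp_cost n (inst a g)) \<ge> n + t / 6000000 - r"
proof -
  let ?adj = "vadj l a g"
  obtain p where p: "p permutes {0..<n}" "tsp_cost n (inst a g) = tour_cost n (inst a g) p"
    using tsp_cost_attained by blast
  define w where "w i = dec (p i)" for i
  have "bij_betw p {..<n} {..<n}"
    using permutes_imp_bij[OF p(1)] by (simp add: lessThan_atLeast0)
  then have w: "bij_betw w {..<n} (verts t l m r)"
    using bij_betw_trans[OF _ dec, of p] by (simp add: w_def[abs_def] o_def)
  define bad where "bad = card {i. i < n \<and> \<not> ?adj (w i) (w (Suc i mod n))}"
  have cost: "tsp_cost n (inst a g) = n + bad"
  proof -
    have "tour_cost n (inst a g) p = n + bad"
      unfolding inst_def bad_def w_def by (rule tour_cost_adj_matrix[OF p(1)]) (use n_ge in simp)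
    then show ?thesis
      using p(2) by simp
  qed
  define nb where "nb v u \<longleftrightarrow> (\<exists>i<n. (v = w i \<and> u = w (Suc i mod n)) \<or> (u = w i \<and> v = w (Suc i mod n)))" for v u
  have cyc: "cyclic_nbrs (verts t l m r) nb"
    unfolding nb_def by (rule cyclic_nbrs_of_enum[OF w]) (use n_ge in simp)
  interpret cyclic_nbrs "verts t l m r" nb
    by (rule cyc)
  interpret ladder_tour t l m r nb a g D
    by unfold_locales (fact l D0 t0 | (rule ptr_bounds[OF a]; assumption))+
  define Bad where "Bad = {v \<in> verts t l m r. \<not> saturated v}"
  have "card {v \<in> verts t l m r. apex v} \<le> r"
  proof -
    have "{v \<in> verts t l m r. apex v} \<subseteq> VU ` {..<r}"
      by (auto simp: verts_def)
    then have "card {v \<in> verts t l m r. apex v} \<le> card (VU ` {..<r})"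
      by (intro card_mono) auto
    also have "\<dots> \<le> r"
      using card_image_le[of "{..<r}" VU] by simp
    finally show ?thesis .
  qed
  moreover have "card Bad \<le> 2 * bad + 2 * card {v \<in> verts t l m r. apex v}"
    unfolding Bad_def bad_def
    by (rule card_unsat_le[OF w]) (use n_ge vadj_sym in \<open>auto simp: nb_def\<close>)
  ultimately have Bad: "card Bad \<le> 2 * bad + 2 * r"
    by linarith
  obtain U where U: "U \<subseteq> {..<t}" "card U \<le> card Bad"
    and le: "card {j. j < m \<and> (\<forall>s<3. sel (g j) s \<noteq> decode (fst (a (j, s))))}
      \<le> card Bad + card {e \<in> {..<m} \<times> {..<3}. fst (a e) \<in> U}"
    using card_unsat_clauses_le unfolding Bad_def by blast
  define x where "x = restrict decode {..<t}"
  have "x \<in> asgs"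
    by (simp add: x_def asgs_def)
  moreover have "unsat a x g = {j. j < m \<and> (\<forall>s<3. sel (g j) s \<noteq> decode (fst (a (j, s))))}"
    using ptr_bounds[OF a] by (auto simp: unsat_def x_def)
  ultimately have "t \<le> card Bad + card {e \<in> idx. fst (a e) \<in> U}"
    using g le unfolding idx_def by fastforce
  then have "real t \<le> card Bad + real (card {e \<in> idx. fst (a e) \<in> U})"
    by (simp flip: of_nat_add)
  \<comment> \<open>The threshold is 1474944 = 2 * (3 * 64 + 737280), which makes the second-moment
    term at most \<open>t / 2\<close>.\<close>
  also have "real (card {e \<in> idx. fst (a e) \<in> U}) \<le> 1474944 * real (card U) + real (card idx + row_collisions a) / 1474944"
    using card_image_in_le[OF finite_idx U(1), of 1474944 "\<lambda>e. fst (a e)"]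
    by (simp only: row_collisions_def of_nat_add)
  also have "real (card idx + row_collisions a) / 1474944 \<le> t / 2"
    using coll card_idx m by simp
  also have "1474944 * real (card U) \<le> 1474944 * real (card Bad)"
    using U(2) by simp
  finally have "real t \<le> 2949890 * real (card Bad)"
    by linarith
  moreover have "real (card Bad) \<le> 2 * real bad + 2 * real r"
    using Bad by linarith
  \<comment> \<open>The factor 2 * 2949890 is rounded up to 6000000.\<close>
  ultimately have "real t / 6000000 \<le> real bad + real r"
    by linarith
  then show ?thesis
    unfolding cost by simp
qed

text \<open>The weights do not depend on \<open>f\<close>, so they are the same for all trees and
  \<open>pmf_average_le\<close> applies.\<close>

lemma mass_diff:
  "planted_mass f - uniform_mass f =
    (\<Sum>p\<in>ptrs \<times> sgns. ((\<Sum>x\<in>asgs. planted (fst p) x (snd p)) / (card ptrs * 2 ^ t * 8 ^ m) - 1 / (card ptrs * 8 ^ m)) * f (fst p) (snd p))"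
proof -
  have "planted_mass f = (\<Sum>a\<in>ptrs. \<Sum>g\<in>sgns. (\<Sum>x\<in>asgs. planted a x g) / (card ptrs * 2 ^ t * 8 ^ m) * f a g)"
    unfolding planted_mass_def
    by (subst sum.swap[of _ sgns asgs]) (simp add: sum_divide_distrib sum_distrib_right)
  moreover have "uniform_mass f = (\<Sum>a\<in>ptrs. \<Sum>g\<in>sgns. 1 / (card ptrs * 8 ^ m) * f a g)"
    unfolding uniform_mass_def by (simp add: sum_divide_distrib)
  ultimately show ?thesis
    by (simp add: sum.cartesian_product case_prod_unfold left_diff_distrib flip: sum_subtractf)
qed

text \<open>Markov thresholds: \<open>737280 * t\<close> is 20 times the bound on the expected number of pointer pairs
  sharing a row, and \<open>D\<close> is so large that \<open>t / 12000000\<close> is at least 20 times the one for pairs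
  sharing a slot.\<close>

lemma query_lower_bound:
  assumes est: "estimates_tsp n Inst c A" and uses: "uses_at_most Inst q A"
    and Inst: "\<And>a g. inst a g \<in> Inst"
    and D: "D = 10 ^ 13" and "c \<ge> 0"
    and gap: "c * (n + t / 12000000 + r + 1) < n + t / 6000000 - r"
  shows "q \<ge> real t ^ 2 * D / 9600000000"
proof (rule ccontr)
  assume "\<not> q \<ge> real t ^ 2 * D / 9600000000"
  then have q: "q < real t ^ 2 * D / 9600000000"
    by simp
  \<comment> \<open>A correct output is at most \<open>\<theta>\<close> on planted instances with
    few collisions and, by \<open>gap\<close>, above \<open>\<theta>\<close> on typical uniform
    ones.\<close>
  define \<theta> where "\<theta> = c * (n + t / 12000000 + r + 1)"
  define K where "K = t div 20000000"
  define acc where "acc a g = measure_pmf.prob A {T. run T (inst a g) \<le> \<theta>}" for a g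
  have tpos: "real t > 0"
    using t0 by simp
  have large: "t * D \<ge> 6"
    using t0 by (simp add: D)
  \<comment> \<open>9600000000 = 24 * 20 * 20000000 bounds the chance of more than \<open>K\<close>
    touched clauses by 1/20.\<close>
  have step: "24 * q / (t * D * Suc K) \<le> 1 / 20"
  proof -
    have "t < 20000000 * Suc K"
      unfolding K_def using dividend_less_times_div[of 20000000 t] by simp
    then have "real t \<le> 20000000 * real (Suc K)"
      by linarith
    then have "real t * (real t * D) \<le> 20000000 * real (Suc K) * (real t * D)"
      by (intro mult_right_mono) auto
    also have "\<dots> = 20000000 * real (t * D * Suc K)"
      by (simp only: of_nat_mult mult_ac)
    finally have "real t * (real t * D) / 400000000 \<le> real (t * D * Suc K) / 20"
      by linarith
    moreover have "24 * q \<le> real t * (real t * D) / 400000000"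
      using q by (simp add: power2_eq_square)
    ultimately have "24 * q \<le> real (t * D * Suc K) / 20"
      by linarith
    moreover have "real (t * D * Suc K) > 0"
      using t0 D0 by (simp only: of_nat_0_less_iff nat_0_less_mult_iff zero_less_Suc)
    ultimately show ?thesis
      by (simp only: pos_divide_le_eq)
  qed
  have tree: "planted_mass (\<lambda>a g. of_bool (run T (inst a g) \<le> \<theta>))
      - uniform_mass (\<lambda>a g. of_bool (run T (inst a g) \<le> \<theta>)) \<le> 1 / 19 + 1 / 20" if "T \<in> set_pmf A" for T
  proof -
    have "planted_mass (\<lambda>a g. of_bool (run T (inst a g) \<le> \<theta>))
      \<le> uniform_mass (\<lambda>a g. of_bool (run T (inst a g) \<le> \<theta>)) + 1 / 19 + 24 * q / (t * D * Suc K)"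
      using uses that Inst
      by (intro planted_mass_run_le[OF m K_def large]) (auto simp: uses_at_most_def)
    then show ?thesis
      using step by linarith
  qed
  have "planted_mass acc - uniform_mass acc \<le> 1 / 19 + 1 / 20"
    unfolding mass_diff acc_def
    by (rule pmf_average_le) (use tree in \<open>simp_all add: mass_diff finite_ptrs finite_sgns\<close>)
  moreover have "planted_mass acc \<ge> 2 / 3 - 1 / 20"
  proof -
    let ?B = "\<lambda>a. real (collisions a) \<ge> t / 12000000"
    have "planted_mass (\<lambda>a g. 2 / 3 - of_bool (?B a)) \<le> planted_mass acc"
      unfolding planted_mass_def
    proof (intro divide_right_mono sum_mono)
      fix a x g assume a: "a \<in> ptrs"
      show "planted a x g * (2 / 3 - of_bool (?B a)) \<le> planted a x g * acc a g"
      proof (cases "planted a x g = 0 \<or> ?B a")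
        case True
        have "acc a g \<ge> 0"
          by (simp add: acc_def)
        then have "planted a x g = 0 \<or> 2 / 3 - of_bool (?B a) \<le> acc a g"
          using True by auto
        then show ?thesis
          using planted_nonneg[of a x g] by (elim disjE) (simp, intro mult_left_mono)
      next
        case False
        then have "real (tsp_cost n (inst a g)) \<le> n + collisions a + r + 1"
          using tsp_cost_planted_le[OF a, of x g] by (simp flip: of_nat_add of_nat_Suc)
        then have "real (tsp_cost n (inst a g)) \<le> n + t / 12000000 + r + 1"
          using False by simp
        then have "c * real (tsp_cost n (inst a g)) \<le> \<theta>"
          unfolding \<theta>_def using \<open>c \<ge> 0\<close> by (intro mult_left_mono)
        then have "measure_pmf.prob A {T. real (tsp_cost n (inst a g)) \<le> run T (inst a g) \<and>
            run T (inst a g) \<le> c * real (tsp_cost n (inst a g))} \<le> acc a g"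
          unfolding acc_def by (intro measure_pmf.finite_measure_mono) auto
        then have "acc a g \<ge> 2 / 3"
          using est Inst unfolding estimates_tsp_def by (meson order_trans)
        then show ?thesis
          using False planted_nonneg[of a x g] by (intro mult_left_mono) auto
      qed
    qed auto
    moreover have "planted_mass (\<lambda>a g. 2 / 3 - of_bool (?B a)) = 2 / 3 - freq ptrs ?B"
    proof -
      have "planted_mass (\<lambda>a g. of_bool True * (2 / 3)) = planted_mass (\<lambda>a g. of_bool True) * (2 / 3)"
        unfolding planted_mass_def mult.assoc[symmetric] sum_distrib_right[symmetric] by simp
      also have "\<dots> = 2 / 3"
        unfolding planted_mass_const using card_ptrs_pos by (simp add: freq_def)
      finally have "2 / 3 = planted_mass (\<lambda>a g. (2 / 3 - of_bool (?B a)) + of_bool (?B a))"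
        by simp
      then show ?thesis
        unfolding planted_mass_add planted_mass_const by simp
    qed
    moreover have "freq ptrs ?B \<le> 9 * real m ^ 2 / (t / 12000000 * (t * D))"
      using tpos by (intro freq_collisions_le) simp
    moreover have "9 * real m ^ 2 / (t / 12000000 * (t * D)) \<le> 1 / 20"
      using tpos by (simp add: m D power2_eq_square field_simps)
    ultimately show ?thesis
      by linarith
  qed
  moreover have "uniform_mass acc \<le> 1 / 3 + 1 / 10"
  proof -
    let ?B = "\<lambda>a. real (row_collisions a) \<ge> 737280 * real t"
    let ?F = "\<lambda>a g. \<exists>x\<in>asgs. card (unsat a x g) < t"
    have "uniform_mass acc \<le> uniform_mass (\<lambda>a g. 1 / 3 + (of_bool (?B a) + of_bool (?F a g)))"
    proof (rule uniform_mass_mono)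
      fix a g assume a: "a \<in> ptrs"
      show "acc a g \<le> 1 / 3 + (of_bool (?B a) + of_bool (?F a g))"
      proof (cases "?B a \<or> ?F a g")
        case True
        have "acc a g \<le> 1"
          by (simp add: acc_def)
        then show ?thesis
          using True by auto
      next
        case False
        then have "real (tsp_cost n (inst a g)) \<ge> n + t / 6000000 - r"
          by (intro tsp_cost_ge[OF a]) (auto simp: not_less)
        then have cost: "\<theta> < real (tsp_cost n (inst a g))"
          using gap unfolding \<theta>_def by simp
        have "2 / 3 \<le> measure_pmf.prob A {T. real (tsp_cost n (inst a g)) \<le> run T (inst a g) \<and>
            run T (inst a g) \<le> c * real (tsp_cost n (inst a g))}"
          using est Inst unfolding estimates_tsp_def by blast
        also have "\<dots> \<le> measure_pmf.prob A (- {T. run T (inst a g) \<le> \<theta>})"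
          using cost by (intro measure_pmf.finite_measure_mono) auto
        also have "\<dots> = 1 - acc a g"
          unfolding acc_def using measure_pmf.prob_compl[of "{T. run T (inst a g) \<le> \<theta>}" A]
          by (simp add: Compl_eq_Diff_UNIV)
        finally show ?thesis
          using False by simp
      qed
    qed
    also have "\<dots> = 1 / 3 + (freq ptrs ?B + (\<Sum>a\<in>ptrs. freq sgns (?F a)) / card ptrs)"
      unfolding uniform_mass_add unfolding uniform_mass_def freq_sum[OF finite_ptrs] freq_sum[OF finite_sgns]
      using card_ptrs_pos by (simp add: card_sgns sum_divide_distrib mult.commute)
    also have "(\<Sum>a\<in>ptrs. freq sgns (?F a)) \<le> (\<Sum>a\<in>ptrs. 1 / 20)"
      by (intro sum_mono freq_few_unsat_le m)
    also have "(\<Sum>a\<in>ptrs. 1 / 20 :: real) / card ptrs = 1 / 20"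
      using card_ptrs_pos by simp
    also have "freq ptrs ?B \<le> 9 * real m ^ 2 / (737280 * real t * real t)"
      using tpos by (intro freq_row_collisions_le) simp
    also have "9 * real m ^ 2 / (737280 * real t * real t) = 1 / 20"
      using tpos by (simp add: m power2_eq_square)
    finally show ?thesis
      by (simp add: divide_right_mono)
  qed
  \<comment> \<open>The advantage would be at least (2/3 - 1/20) - (1/3 + 1/10) = 11/60, which
    exceeds 1/19 + 1/20.\<close>
  ultimately show False
    by simp
qed

end


section \<open>Choice of parameters for every large n\<close>

lemma tsp_query_lower_bound:
  fixes Inst :: "nat \<Rightarrow> (nat \<Rightarrow> nat \<Rightarrow> nat) set"
  assumes Inst: "\<And>t D r dec l m n a g. hard_instances t D r dec l m n \<Longrightarrow>
    hard_instances.inst dec l n a g \<in> Inst n"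
  shows "\<exists>\<epsilon>0>0. \<exists>c>0. \<exists>N. \<forall>n\<ge>N. \<forall>A q.
    estimates_tsp n (Inst n) (1 + \<epsilon>0) A \<and> uses_at_most (Inst n) q A \<longrightarrow> q \<ge> c * real n ^ 2"
proof -
  define D :: nat where "D = 10 ^ 13"
  define l where "l = 6 * D + 2"
  \<comment> \<open>Vertices per variable: three in each of the \<open>Suc l\<close> columns, and 64
    clauses.\<close>
  define C where "C = 3 * Suc l + 64"
  \<comment> \<open>The relative error adds at most \<open>t / 25000000\<close>, less than half of
    the \<open>t / 12000000\<close> between the two cost bounds; the rest of the gap absorbs the
    apex vertices.\<close>
  define \<epsilon> :: real where "\<epsilon> = 1 / (100000000 * (C + 1))"
  define c :: real where "c = D / (9600000000 * (2 * real C) ^ 2)"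
  define N where "N = C * (100000000 * (2 * C + 1) + 1) + C"
  have "C > 0" "D > 0"
    by (simp_all add: C_def D_def)
  then have pos: "\<epsilon> > 0" "c > 0"
    by (simp_all add: \<epsilon>_def c_def)
  have main: "q \<ge> c * real n ^ 2"
    if n: "n \<ge> N" and est: "estimates_tsp n (Inst n) (1 + \<epsilon>) A" and uses: "uses_at_most (Inst n) q A" for n A q
  proof -
    \<comment> \<open>Dividing n - 1 instead of n leaves a remainder \<open>r\<close> between 1 and
      \<open>C\<close>: the apex vertices pad the instance to any size, and at least one is
      present.\<close>
    define t where "t = (n - 1) div C"
    define r where "r = n - C * t"
    have "n > 0"
      using n \<open>C > 0\<close> by (simp add: N_def)
    have Ct: "C * t + (n - 1) mod C = n - 1"
      unfolding t_def by (rule mult_div_mod_eq)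
    then have nr: "n = C * t + r" and r: "r > 0" "r \<le> C"
      using \<open>n > 0\<close> \<open>C > 0\<close> mod_less_divisor[of C "n - 1"] unfolding r_def by linarith+
    have t_ge: "t \<ge> 100000000 * (2 * C + 1)"
    proof (rule ccontr)
      assume "\<not> t \<ge> 100000000 * (2 * C + 1)"
      then have "C * t \<le> C * (100000000 * (2 * C + 1))"
        by (intro mult_left_mono) auto
      then have "n \<le> C * (100000000 * (2 * C + 1)) + C"
        using nr r by linarith
      moreover have "N = C * (100000000 * (2 * C + 1)) + C + C"
        unfolding N_def by (simp only: distrib_left mult_1_right)
      ultimately show False
        using n \<open>C > 0\<close> by linarith
    qed
    have "t > 0"
      using t_ge by simp
    define m where "m = 64 * t"
    have n': "n = 3 * (t * Suc l) + m + r"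
      using nr by (simp add: C_def m_def algebra_simps)
    have "card {..<n} = card (verts t l m r)"
      by (simp only: card_verts n' card_lessThan)
    then obtain dec where dec: "bij_betw dec {..<n} (verts t l m r)"
      using finite_same_card_bij[of "{..<n}"] finite_verts by blast
    have hard: "hard_instances t D r dec l m n"
      by (rule hard_instances.intro) (fact \<open>t > 0\<close> \<open>D > 0\<close> r l_def m_def n' dec)+
    have tr: "real t \<ge> 100000000 * (2 * real C + 1)"
      using of_nat_mono[OF t_ge, where 'a = real] by simp
    have rr: "real r \<le> real C"
      using r by simp
    have nn: "real n = real C * real t + real r"
      unfolding nr by simp
    have "(C + 1) * (4 * real t) \<ge> real n + t / 12000000 + r + 1"
    proof -
      have "(C + 1) * (4 * real t) = 4 * (real C * real t) + 4 * real t"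
        by (simp add: algebra_simps)
      moreover have "real C * real t \<ge> 0"
        by simp
      moreover have "real t \<ge> real C"
        using tr by simp
      moreover have "real t \<ge> 1"
        using \<open>t > 0\<close> by simp
      ultimately show ?thesis
        using nn rr by linarith
    qed
    then have "\<epsilon> * (real n + t / 12000000 + r + 1) \<le> \<epsilon> * ((C + 1) * (4 * real t))"
      using pos by (intro mult_left_mono) auto
    also have "\<dots> = t / 25000000"
      by (simp add: \<epsilon>_def field_simps)
    finally have "\<epsilon> * (real n + t / 12000000 + r + 1) \<le> t / 25000000" .
    then have "real n + t / 12000000 + r + 1 + \<epsilon> * (real n + t / 12000000 + r + 1) < real n + t / 6000000 - r"
      if "t / 25000000 + t / 12000000 + 2 * real r + 1 < t / 6000000"
      using that by linarith
    moreover have "t / 25000000 + t / 12000000 + 2 * real r + 1 < t / 6000000"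
      using tr rr by (simp add: field_simps)
    ultimately have gap: "(1 + \<epsilon>) * (real n + t / 12000000 + r + 1) < real n + t / 6000000 - r"
      unfolding distrib_right[of 1 \<epsilon>] mult_1_left by blast
    have "q \<ge> real t ^ 2 * D / 9600000000"
      using hard_instances.query_lower_bound[OF hard est uses Inst[OF hard] D_def _ gap] pos by simp
    moreover have "c * real n ^ 2 \<le> real t ^ 2 * D / 9600000000"
    proof -
      have "real C * 1 \<le> real C * real t"
        using \<open>t > 0\<close> by (intro mult_left_mono) auto
      then have "real n \<le> 2 * real C * real t"
        using nn rr by simp
      then have "real n ^ 2 \<le> (2 * real C * real t) ^ 2"
        by (intro power_mono) auto
      then have "c * real n ^ 2 \<le> c * (2 * real C * real t) ^ 2"
        using pos by (intro mult_left_mono) auto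
      also have "\<dots> = real t ^ 2 * D / 9600000000"
        using \<open>C > 0\<close> by (simp add: c_def power_mult_distrib)
      finally show ?thesis .
    qed
    ultimately show ?thesis
      by linarith
  qed
  show ?thesis
    using pos main by blast
qed

theorem theorem1p6:
  shows "(\<exists>\<epsilon>0>0. \<exists>c>0. \<exists>N. \<forall>n\<ge>N. \<forall>A q.
            estimates_tsp n (graphic_instances n) (1 + \<epsilon>0) A \<and>
            uses_at_most (graphic_instances n) q A \<longrightarrow> q \<ge> c * real n ^ 2)
       \<and> (\<exists>\<epsilon>0>0. \<exists>c>0. \<exists>N. \<forall>n\<ge>N. \<forall>A q.
            estimates_tsp n (onetwo_instances n) (1 + \<epsilon>0) A \<and>
            uses_at_most (onetwo_instances n) q A \<longrightarrow> q \<ge> c * real n ^ 2)"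
  by (intro conjI tsp_query_lower_bound)
    (simp_all add: hard_instances.inst_graphic hard_instances.inst_onetwo)

end
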